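(* Let $\beta\in(0,1)$, $A<0$, let $h:\mathbb{R}\to\mathbb{R}$ be measurable, and let $\mathcal{E}$ be a family of continuous functions $\xi:[0,\infty)\to\mathbb{R}$ contained in a normed linear space $(\mathcal{X},\|\cdot\|_{\mathcal{X}})$ of functions. For $\xi\in\mathcal{E}$ consider the equations $$X(t)=\xi_t+\frac{1}{\Gamma(\beta)}\int_0^t (t-s)^{\beta-1}[A X(s)+h(X(s))]\,ds,\quad t\ge0,\qquad (1)$$ $$Y(t)=\xi_t+\frac{1}{\Gamma(\beta)}\int_0^t (t-s)^{\beta-1}A Y(s)\,ds,\quad t\ge0.\qquad (2)$$ (a) Suppose there are $\delta_0>0$ and $C>0$ such that $A+C<0$ and $|h(x)|\le C|x|$ for all $|x|<\delta_0$. If the solution of (2) is asymptotically $\mathcal{E}$-stable, then any continuous solution of (1) is also asymptotically $\mathcal{E}$-stable. (b) Suppose there is $C>0$ such that $A+C<0$ and $|h(x)|\le C|x|$ for all $x\in\mathbb{R}$. If the solution of (2) is globally $\mathcal{E}$-stable in the large, then any continuous solution of (1) is also globally $\mathcal{E}$-stable in the large.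
   Context: $\Gamma$ is the Gamma function. Solutions are functions on $[0,\infty)$; (2) has a unique continuous solution for each continuous $\xi$. For either equation, (any) continuous solution is said to be: - globally $\mathcal{E}$-stable in the large if for every $\xi\in\mathcal{E}$ every continuous solution of the equation with initial condition $\xi$ tends to $0$ as $t\to\infty$; - $\mathcal{E}$-stable if for every $\varepsilon>0$ there is $\delta>0$ such that for every $\xi\in\mathcal{E}$ with $\|\xi\|_{\mathcal{X}}<\delta$, every continuous solution $X$ of the equation with initial condition $\xi$ satisfies $\sup_{t\ge0}|X(t)|<\varepsilon$; - asymptotically $\mathcal{E}$-stable if it is $\mathcal{E}$-stable and there is $\delta>0$ such that for every $\xi\in\mathcal{E}$ with $\|\xi\|_{\mathcal{X}}<\delta$ every continuous solution with initial condition $\xi$ tends to $0$ as $t\to\infty$. *)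

theory Defs
  imports "HOL-Analysis.Analysis"
begin

text \<open>
  A function on \<open>[0,\<infinity>)\<close> is represented by a function on \<open>real\<close> whose values at negative
  arguments play no role.
\<close>

text \<open>
  The axioms are those of the class \<^class>\<open>real_normed_vector\<close>, relativised to a carrier \<open>V\<close>
  with pointwise operations. Definiteness is stated on \<open>[0,\<infinity>)\<close>; with the triangle inequality it
  makes \<open>nrm\<close> depend on the restriction to \<open>[0,\<infinity>)\<close> only. Nonnegativity of \<open>nrm\<close> follows.
\<close>

definition normed_function_space ::
    "(real \<Rightarrow> real) set \<Rightarrow> ((real \<Rightarrow> real) \<Rightarrow> real) \<Rightarrow> bool" where
  "normed_function_space V nrm \<longleftrightarrow>
     (\<lambda>t. 0) \<in> V \<and>
     (\<forall>f\<in>V. \<forall>g\<in>V. (\<lambda>t. f t + g t) \<in> V) \<and>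
     (\<forall>c. \<forall>f\<in>V. (\<lambda>t. c * f t) \<in> V) \<and>
     (\<forall>f\<in>V. nrm f = 0 \<longleftrightarrow> (\<forall>t\<ge>0. f t = 0)) \<and>
     (\<forall>f\<in>V. \<forall>g\<in>V. nrm (\<lambda>t. f t + g t) \<le> nrm f + nrm g) \<and>
     (\<forall>c. \<forall>f\<in>V. nrm (\<lambda>t. c * f t) = \<bar>c\<bar> * nrm f)"

text \<open>
  \<open>X\<close> is a continuous solution of
  \<open>X(t) = \<xi>(t) + 1/\<Gamma>(\<beta>) \<integral>\<^sub>0\<^sup>t (t - s)\<^sup>\<beta>\<^sup>-\<^sup>1 F(X(s)) ds\<close> for \<open>t \<ge> 0\<close>.
  Lebesgue integrability has to be demanded explicitly, because the Bochner integral of a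
  non-integrable function is \<open>0\<close> by convention. At the single point \<open>s = t\<close> the kernel takes the
  value \<open>0 powr (\<beta> - 1) = 0\<close>, which does not affect the integral.
\<close>

definition continuous_solution ::
    "real \<Rightarrow> (real \<Rightarrow> real) \<Rightarrow> (real \<Rightarrow> real) \<Rightarrow> (real \<Rightarrow> real) \<Rightarrow> bool" where
  "continuous_solution \<beta> F \<xi> X \<longleftrightarrow>
     continuous_on {0..} X \<and>
     (\<forall>t\<ge>0. set_integrable lborel {0..t} (\<lambda>s. (t - s) powr (\<beta> - 1) * F (X s)) \<and>
            X t = \<xi> t + 1 / Gamma \<beta> *
                    (LBINT s:{0..t}. (t - s) powr (\<beta> - 1) * F (X s)))"

text \<open>
  Stability of an equation, given by the relation \<open>sol \<xi> X\<close>: ``\<open>X\<close> is a continuous solution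
  with initial condition \<open>\<xi>\<close>''.
\<close>

definition globally_stable_in_the_large ::
    "(real \<Rightarrow> real) set \<Rightarrow> ((real \<Rightarrow> real) \<Rightarrow> (real \<Rightarrow> real) \<Rightarrow> bool) \<Rightarrow> bool" where
  "globally_stable_in_the_large E sol \<longleftrightarrow>
     (\<forall>\<xi>\<in>E. \<forall>X. sol \<xi> X \<longrightarrow> (X \<longlongrightarrow> 0) at_top)"

text \<open>The supremum is taken in the extended reals, so that it is \<open>\<infinity>\<close> for unbounded \<open>X\<close>.\<close>

definition stable ::
    "(real \<Rightarrow> real) set \<Rightarrow> ((real \<Rightarrow> real) \<Rightarrow> real) \<Rightarrow>
     ((real \<Rightarrow> real) \<Rightarrow> (real \<Rightarrow> real) \<Rightarrow> bool) \<Rightarrow> bool" where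
  "stable E nrm sol \<longleftrightarrow>
     (\<forall>\<epsilon>>0. \<exists>\<delta>>0. \<forall>\<xi>\<in>E. nrm \<xi> < \<delta> \<longrightarrow>
        (\<forall>X. sol \<xi> X \<longrightarrow> (SUP t\<in>{0..}. ereal \<bar>X t\<bar>) < ereal \<epsilon>))"

definition asymptotically_stable ::
    "(real \<Rightarrow> real) set \<Rightarrow> ((real \<Rightarrow> real) \<Rightarrow> real) \<Rightarrow>
     ((real \<Rightarrow> real) \<Rightarrow> (real \<Rightarrow> real) \<Rightarrow> bool) \<Rightarrow> bool" where
  "asymptotically_stable E nrm sol \<longleftrightarrow>
     stable E nrm sol \<and>
     (\<exists>\<delta>>0. \<forall>\<xi>\<in>E. nrm \<xi> < \<delta> \<longrightarrow> (\<forall>X. sol \<xi> X \<longrightarrow> (X \<longlongrightarrow> 0) at_top))"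

end

theory Submission
  imports Defs
begin

text \<open>
  Put \<open>\<lambda> = -A > 0\<close>. If \<open>X\<close> and \<open>Y\<close> solve (1) and (2) with the same \<open>\<xi>\<close>, then \<open>Z = X - Y\<close> is the
  fractional integral of order \<open>\<beta>\<close> of \<open>h(X) - \<lambda> Z\<close>, and everything follows from a comparison
  principle: if \<open>Z\<close> is the fractional integral of \<open>g - \<lambda> Z\<close> and \<open>g \<le> \<lambda> m\<close> on \<open>[0,T]\<close>, where \<open>m \<ge> 0\<close>,
  then \<open>Z \<le> m\<close> there. It is proved without Mittag-Leffler functions: if \<open>Z\<close> has its maximum
  \<open>M > m\<close> at \<open>t\<^sub>1\<close> and \<open>t\<^sub>0 < t\<^sub>1\<close> is the last earlier time with \<open>Z \<le> m\<close>, then dropping the nonpositive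
  contribution of \<open>(t\<^sub>0, t\<^sub>1)\<close> and writing the kernel seen from \<open>t\<^sub>1\<close> as a mixture of kernels seen from
  points of \<open>(0, t\<^sub>0)\<close>, with total weight less than \<open>1\<close>, bounds \<open>M\<close> by a proper fraction of \<open>M\<close>.

  With \<open>r = C / \<lambda> < 1\<close>, comparison gives \<open>sup |X| \<le> sup |Y| / (1 - r)\<close> on any interval where
  \<open>|h(X)| \<le> C |X|\<close>; in (a) a first-exit argument keeps \<open>X\<close> in the region where this holds.
  For the decay, let \<open>P\<close> be the fractional integral of \<open>1 - \<lambda> P\<close>. By comparison \<open>P\<close> is increasing
  and bounded, so \<open>P(t) - P(t - T)\<close>, which is the response to the source \<open>1\<close> on \<open>[0,T)\<close>, tends to \<open>0\<close>:
  the past of \<open>h(X)\<close> is forgotten. Hence if eventually \<open>|X| \<le> q\<close>, then eventually \<open>|X| \<le> r q + \<epsilon>\<close>,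
  and so \<open>X\<close> tends to \<open>0\<close>. The stability hypothesis says nothing unless \<open>Y\<close> exists, which follows from
  a contraction argument for bounded \<open>\<xi>\<close> and uniqueness, again by comparison.
\<close>

subsection \<open>The Abel kernel\<close>

text \<open>With the value \<open>0\<close> at nonpositive arguments,
  \<open>abel_kernel \<beta> (t - s)\<close> vanishes for \<open>s \<ge> t\<close>. Integrals over
  \<open>[0,t]\<close> thus become integrals over the whole line, and Fubini and substitutions need
  no bookkeeping of limits.\<close>

definition abel_kernel :: "real \<Rightarrow> real \<Rightarrow> real" where
  "abel_kernel \<beta> t = (if 0 < t then t powr (\<beta> - 1) else 0)"

lemma abel_kernel_nonneg: "0 \<le> abel_kernel \<beta> t"
  by (simp add: abel_kernel_def)

lemma abel_kernel_measurable [measurable]: "abel_kernel \<beta> \<in> borel_measurable borel"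
  unfolding abel_kernel_def by measurable

lemma integrable_abel_kernel_0:
  assumes "0 < \<beta>"
  shows "integrable lborel (\<lambda>s. indicator {0..t} s * abel_kernel \<beta> s)"
proof -
  \<comment> \<open>\<open>max 0 t\<close> covers negative \<open>t\<close>: the interval then
    shrinks to the point \<open>0\<close>, where \<open>powr\<close> has the value
    \<open>0\<close>.\<close>
  have "(\<lambda>s. s powr (\<beta> - 1)) integrable_on {0..max 0 t}"
    by (rule integrable_on_powr_from_0) (use assms in auto)
  hence "(\<lambda>s. s powr (\<beta> - 1)) absolutely_integrable_on {0..max 0 t}"
    by (subst absolutely_integrable_on_iff_nonneg) auto
  hence "integrable lborel (\<lambda>s. indicator {0..max 0 t} s * s powr (\<beta> - 1))"
    unfolding set_integrable_def by (subst (asm) integrable_completion) auto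
  also have "(\<lambda>s. indicator {0..max 0 t} s * s powr (\<beta> - 1)) = (\<lambda>s. indicator {0..t} s * abel_kernel \<beta> s)"
    by (auto simp: fun_eq_iff abel_kernel_def indicator_def)
  finally show ?thesis .
qed

lemma integrable_abel_kernel:
  assumes "0 < \<beta>"
  shows "integrable lborel (\<lambda>s. indicator {0..} s * abel_kernel \<beta> (t - s))"
proof -
  have "integrable lborel (\<lambda>s. indicator {0..t} (t + (-1) * s) * abel_kernel \<beta> (t + (-1) * s))"
    by (rule lborel_integrable_real_affine[OF integrable_abel_kernel_0]) (use assms in auto)
  also have "(\<lambda>s. indicator {0..t} (t + (-1) * s) * abel_kernel \<beta> (t + (-1) * s)) 
     = (\<lambda>s. indicator {0..} s * abel_kernel \<beta> (t - s))"
    by (auto simp: fun_eq_iff abel_kernel_def indicator_def)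
  finally show ?thesis .
qed

text \<open>The integrand is dominated by \<open>B\<close> times the kernel on \<open>{0..}\<close>.
  A bound on \<open>[0,t]\<close> suffices, because the kernel vanishes beyond
  \<open>t\<close>.\<close>

lemma integrable_abel_kernel_mult:
  assumes "0 < \<beta>" and [measurable]: "f \<in> borel_measurable borel"
    and "\<And>s. s < 0 \<Longrightarrow> f s = 0" and "\<And>s. 0 \<le> s \<Longrightarrow> s \<le> t \<Longrightarrow> \<bar>f s\<bar> \<le> B"
  shows "integrable lborel (\<lambda>s. abel_kernel \<beta> (t - s) * f s)"
proof (rule Bochner_Integration.integrable_bound)
  show "integrable lborel (\<lambda>s. B * (indicator {0..} s * abel_kernel \<beta> (t - s)))"
    using integrable_abel_kernel[OF assms(1)] by simp
  show "AE s in lborel. norm (abel_kernel \<beta> (t - s) * f s) \<le> norm (B * (indicator {0..} s * abel_kernel \<beta> (t - s)))"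
  proof (rule AE_I2)
    fix s
    show "norm (abel_kernel \<beta> (t - s) * f s) \<le> norm (B * (indicator {0..} s * abel_kernel \<beta> (t - s)))"
      using assms(3)[of s] assms(4)[of s] abel_kernel_nonneg[of \<beta> "t - s"]
      by (cases "0 \<le> s \<and> s \<le> t") (auto simp: abs_mult mult.commute abel_kernel_def intro!: mult_right_mono)
  qed
qed auto

text \<open>For \<open>d = v + b\<close>, \<open>p = a + b\<close>, \<open>q = a - v\<close> the
  factors on the left are \<open>x powr (- \<beta>)\<close>,
  \<open>(1 - x) powr (\<beta> - 1)\<close> and \<open>dx/dv\<close> for the substitution in
  \<open>balayage_integral\<close>. Independent letters reduce the identity to the laws of
  powers.\<close>

lemma beta_substitution_identity:
  fixes a b d p q v \<beta> :: real
  assumes "0 < a" "0 < b" "0 < d" "0 < p" "0 < q" "0 < v"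
  shows "(v * p / (a * d)) powr (- \<beta>) * (b * q / (a * d)) powr (\<beta> - 1) * (p * b / (a * d\<^sup>2))
    = b powr \<beta> * p powr (1 - \<beta>) * (q powr (\<beta> - 1) * v powr (- \<beta>) / d)"
  using assms
  by (simp add: powr_mult powr_divide powr_minus powr_diff power2_eq_square)
     (simp add: divide_simps)

text \<open>
  The substitution \<open>x = v (a + b) / (a (v + b))\<close> turns the Beta integral into the integral below.
\<close>

lemma balayage_integral:
  fixes a b \<beta> :: real
  assumes "0 < \<beta>" "\<beta> < 1" "0 < a" "0 < b"
  shows "(\<integral>\<^sup>+v. ennreal (indicator {0<..<a} v * ((a - v) powr (\<beta> - 1) * v powr (- \<beta>) / (b + v))) \<partial>lborel)
    = ennreal (Beta (1 - \<beta>) \<beta> * b powr (- \<beta>) * (a + b) powr (\<beta> - 1))"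
proof -
  define g where "g = (\<lambda>v. v * (a + b) / (a * (v + b)))"
  define g' where "g' = (\<lambda>v. (a + b) * b / (a * (v + b)\<^sup>2))"
  define f where "f = (\<lambda>x::real. x powr (- \<beta>) * (1 - x) powr (\<beta> - 1))"
  define c where "c = b powr \<beta> * (a + b) powr (1 - \<beta>)"
  have [measurable]: "f \<in> borel_measurable borel"
    unfolding f_def by measurable
  have g0: "g 0 = 0" and ga: "g a = 1"
    using assms by (auto simp: g_def divide_simps)
  have "(f has_integral Beta (1 - \<beta>) \<beta>) {0..1}"
    using has_integral_Beta_real[of "1 - \<beta>" \<beta>] assms by (simp add: f_def)
  from nn_integral_has_integral_lebesgue[OF _ this]
  have "ennreal (Beta (1 - \<beta>) \<beta>) = (\<integral>\<^sup>+x. ennreal (f x * indicator {g 0..g a} x) \<partial>lborel)"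
    by (simp add: f_def g0 ga mult_ac)
  also have "\<dots> = (\<integral>\<^sup>+v. ennreal (f (g v) * g' v * indicator {0..a} v) \<partial>lborel)"
  proof (rule nn_integral_substitution)
    show "set_borel_measurable borel {g 0..g a} f" 
      unfolding set_borel_measurable_def by measurable
    show "(g has_real_derivative g' x) (at x)" if "x \<in> {0..a}" for x
      unfolding g_def g'_def using that assms
      by (auto intro!: derivative_eq_intros simp: divide_simps power2_eq_square) (simp add: algebra_simps)
    show "continuous_on {0..a} g'"
      unfolding g'_def using assms by (auto intro!: continuous_intros)
  qed (use assms in \<open>auto simp: g'_def\<close>)
  also have "\<dots> = (\<integral>\<^sup>+v. ennreal c * ennreal (indicator {0<..<a} v * ((a - v) powr (\<beta> - 1) * v powr (- \<beta>) / (b + v))) \<partial>lborel)"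
  proof (intro nn_integral_cong_AE)
    \<comment> \<open>The substitution lives on the closed interval and the claim on the open one;
      the endpoints form a null set.\<close>
    have "AE v in lborel. v \<noteq> 0" "AE v in lborel. v \<noteq> a"
      by (simp_all add: AE_lborel_singleton)
    then show "AE v in lborel. ennreal (f (g v) * g' v * indicator {0..a} v) =
      ennreal c * ennreal (indicator {0<..<a} v * ((a - v) powr (\<beta> - 1) * v powr (- \<beta>) / (b + v)))"
    proof eventually_elim
      case (elim v)
      show ?case
      proof (cases "0 < v \<and> v < a")
        case True
        have 1: "1 - g v = b * (a - v) / (a * (v + b))"
        proof -
          have "a * (v + b) \<noteq> 0" using True assms by auto
          then show ?thesis by (simp add: g_def divide_simps) (simp add: algebra_simps)
        qed
        have "f (g v) * g' v = c * ((a - v) powr (\<beta> - 1) * v powr (- \<beta>) / (b + v))"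
          unfolding f_def 1 unfolding g_def g'_def c_def
          using beta_substitution_identity[of a b "v + b" "a + b" "a - v" v \<beta>] True assms
          by (simp add: add.commute)
        thus ?thesis
          using True assms by (simp flip: ennreal_mult' add: c_def)
      qed (use elim in \<open>auto simp: indicator_def\<close>)
    qed
  qed
  also have "\<dots> = ennreal c * (\<integral>\<^sup>+v. ennreal (indicator {0<..<a} v * ((a - v) powr (\<beta> - 1) * v powr (- \<beta>) / (b + v))) \<partial>lborel)"
    by (rule nn_integral_cmult) measurable
  finally have eq: "ennreal (Beta (1 - \<beta>) \<beta>) = ennreal c * (\<integral>\<^sup>+v. ennreal (indicator {0<..<a} v * ((a - v) powr (\<beta> - 1) * v powr (- \<beta>) / (b + v))) \<partial>lborel)" (is "_ = _ * ?I") .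
  have c: "c > 0" using assms by (simp add: c_def)
  \<comment> \<open>Since \<open>c\<close> is positive and finite, it cancels without prior
    knowledge that \<open>?I\<close> is finite.\<close>
  have "?I = ennreal (1 / c) * (ennreal c * ?I)"
    using c by (simp flip: mult.assoc ennreal_mult')
  also have "\<dots> = ennreal (1 / c * Beta (1 - \<beta>) \<beta>)"
    unfolding eq[symmetric] using c by (simp add: ennreal_mult'[symmetric])
  also have "1 / c * Beta (1 - \<beta>) \<beta> = Beta (1 - \<beta>) \<beta> * b powr (- \<beta>) * (a + b) powr (\<beta> - 1)"
    using assms by (simp add: c_def powr_minus powr_diff field_simps)
  finally show ?thesis .
qed

subsection \<open>Balayage and the maximum principle\<close>

text \<open>
  The density on \<open>(0, t\<^sub>0)\<close> onto which the Abel kernel seen from \<open>t\<^sub>1 > t\<^sub>0\<close> is swept; it is the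
  overshoot law of a \<open>\<beta>\<close>-stable subordinator.
\<close>

definition balayage :: "real \<Rightarrow> real \<Rightarrow> real \<Rightarrow> real \<Rightarrow> real" where
  "balayage \<beta> t\<^sub>0 t\<^sub>1 u = (if 0 < u \<and> u < t\<^sub>0
     then (t\<^sub>1 - t\<^sub>0) powr \<beta> / Beta (1 - \<beta>) \<beta> * (t\<^sub>0 - u) powr (- \<beta>) / (t\<^sub>1 - u) else 0)"

lemma balayage_measurable [measurable]: "balayage \<beta> t\<^sub>0 t\<^sub>1 \<in> borel_measurable borel"
  unfolding balayage_def by measurable

lemma Beta_real_pos: "0 < a \<Longrightarrow> 0 < b \<Longrightarrow> 0 < Beta a (b::real)"
  by (simp add: Beta_def Gamma_real_pos)

lemma balayage_nonneg:
  assumes "0 < \<beta>" "\<beta> < 1" "t\<^sub>0 < t\<^sub>1"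
  shows "0 \<le> balayage \<beta> t\<^sub>0 t\<^sub>1 u"
  using assms Beta_real_pos[of "1 - \<beta>" \<beta>] by (auto simp: balayage_def)

text \<open>This is the sweeping identity. Points \<open>u \<le> s\<close> do not see
  \<open>s\<close>, so the reflection \<open>u = t\<^sub>0 - v\<close> leaves
  \<open>balayage_integral\<close> with \<open>a = t\<^sub>0 - s\<close> and
  \<open>b = t\<^sub>1 - t\<^sub>0\<close>. The constant in the density cancels the Beta value and
  the power of \<open>b\<close>.\<close>

lemma nn_integral_balayage_abel_kernel:
  assumes "0 < \<beta>" "\<beta> < 1" "0 \<le> s" "s < t\<^sub>0" "t\<^sub>0 < t\<^sub>1"
  shows "(\<integral>\<^sup>+u. ennreal (balayage \<beta> t\<^sub>0 t\<^sub>1 u * abel_kernel \<beta> (u - s)) \<partial>lborel) = ennreal (abel_kernel \<beta> (t\<^sub>1 - s))"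
proof -
  define c where "c = (t\<^sub>1 - t\<^sub>0) powr \<beta> / Beta (1 - \<beta>) \<beta>"
  have B: "0 < Beta (1 - \<beta>) \<beta>"
    using assms by (intro Beta_real_pos) auto
  have c: "0 < c" using B assms by (simp add: c_def)
  have "(\<integral>\<^sup>+u. ennreal (balayage \<beta> t\<^sub>0 t\<^sub>1 u * abel_kernel \<beta> (u - s)) \<partial>lborel)
    = (\<integral>\<^sup>+v. ennreal (balayage \<beta> t\<^sub>0 t\<^sub>1 (t\<^sub>0 - v) * abel_kernel \<beta> (t\<^sub>0 - v - s)) \<partial>lborel)"
    by (subst nn_integral_real_affine[where c = "-1" and t = t\<^sub>0]) auto
  also have "\<dots> = (\<integral>\<^sup>+v. ennreal c * ennreal (indicator {0<..<t\<^sub>0 - s} v *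
      ((t\<^sub>0 - s - v) powr (\<beta> - 1) * v powr (- \<beta>) / (t\<^sub>1 - t\<^sub>0 + v))) \<partial>lborel)"
    using c assms
    by (intro nn_integral_cong)
       (auto simp: balayage_def abel_kernel_def indicator_def c_def[symmetric] ennreal_mult'[symmetric]
          algebra_simps)
  also have "\<dots> = ennreal c * (\<integral>\<^sup>+v. ennreal (indicator {0<..<t\<^sub>0 - s} v *
      ((t\<^sub>0 - s - v) powr (\<beta> - 1) * v powr (- \<beta>) / (t\<^sub>1 - t\<^sub>0 + v))) \<partial>lborel)"
    by (rule nn_integral_cmult) measurable
  also have "\<dots> = ennreal (c * (Beta (1 - \<beta>) \<beta> * (t\<^sub>1 - t\<^sub>0) powr (- \<beta>) * (t\<^sub>1 - s) powr (\<beta> - 1)))"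
    using c assms by (subst balayage_integral) (auto simp: ennreal_mult')
  also have "c * (Beta (1 - \<beta>) \<beta> * (t\<^sub>1 - t\<^sub>0) powr (- \<beta>) * (t\<^sub>1 - s) powr (\<beta> - 1)) = abel_kernel \<beta> (t\<^sub>1 - s)"
    using assms B by (simp add: c_def abel_kernel_def powr_minus)
  finally show ?thesis .
qed

text \<open>Take \<open>s = 0\<close> in the sweeping identity. The kernel is decreasing, so on
  \<open>(0, t\<^sub>0)\<close> it is at least its value at \<open>t\<^sub>0\<close>; the mass is
  therefore at most the ratio of the kernel at \<open>t\<^sub>1\<close> to the kernel at
  \<open>t\<^sub>0\<close>, which is below \<open>1\<close>.\<close>

lemma balayage_mass:
  assumes "0 < \<beta>" "\<beta> < 1" "0 < t\<^sub>0" "t\<^sub>0 < t\<^sub>1"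
  shows "integrable lborel (balayage \<beta> t\<^sub>0 t\<^sub>1)" "(LINT u|lborel. balayage \<beta> t\<^sub>0 t\<^sub>1 u) < 1"
proof -
  let ?\<mu> = "balayage \<beta> t\<^sub>0 t\<^sub>1"
  have k: "0 < abel_kernel \<beta> t\<^sub>0" "abel_kernel \<beta> t\<^sub>1 < abel_kernel \<beta> t\<^sub>0"
    using assms by (auto simp: abel_kernel_def intro!: powr_less_mono2_neg)
  have nonneg: "0 \<le> ?\<mu> u" for u
    using assms by (intro balayage_nonneg) auto
  have "ennreal (abel_kernel \<beta> t\<^sub>0) * (\<integral>\<^sup>+u. ennreal (?\<mu> u) \<partial>lborel) = (\<integral>\<^sup>+u. ennreal (?\<mu> u * abel_kernel \<beta> t\<^sub>0) \<partial>lborel)"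
    using nonneg by (subst nn_integral_cmult[symmetric]) (auto simp: ennreal_mult mult.commute abel_kernel_nonneg)
  also have "\<dots> \<le> (\<integral>\<^sup>+u. ennreal (?\<mu> u * abel_kernel \<beta> (u - 0)) \<partial>lborel)"
  proof (intro nn_integral_mono ennreal_leI)
    fix u
    show "?\<mu> u * abel_kernel \<beta> t\<^sub>0 \<le> ?\<mu> u * abel_kernel \<beta> (u - 0)"
    proof (cases "0 < u \<and> u < t\<^sub>0")
      case True
      then have "abel_kernel \<beta> t\<^sub>0 \<le> abel_kernel \<beta> u"
        using assms by (auto simp: abel_kernel_def intro!: powr_mono2')
      then show ?thesis using nonneg[of u] by (simp add: mult_left_mono)
    qed (auto simp: balayage_def)
  qed
  also have "\<dots> = ennreal (abel_kernel \<beta> t\<^sub>1)"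
    using nn_integral_balayage_abel_kernel[of \<beta> 0 t\<^sub>0 t\<^sub>1] assms by simp
  finally have *: "ennreal (abel_kernel \<beta> t\<^sub>0) * (\<integral>\<^sup>+u. ennreal (?\<mu> u) \<partial>lborel) \<le> ennreal (abel_kernel \<beta> t\<^sub>1)" .
  have "ennreal (abel_kernel \<beta> t\<^sub>0) * (\<integral>\<^sup>+u. ennreal (?\<mu> u) \<partial>lborel) < \<infinity>"
    using * by (rule le_less_trans) simp
  then have fin: "(\<integral>\<^sup>+u. ennreal (?\<mu> u) \<partial>lborel) < \<infinity>"
    using k by (auto simp: ennreal_mult_less_top)
  then show int: "integrable lborel ?\<mu>"
    using nonneg by (subst integrable_iff_bounded) auto
  have "ennreal (abel_kernel \<beta> t\<^sub>0 * (LINT u|lborel. ?\<mu> u)) \<le> ennreal (abel_kernel \<beta> t\<^sub>1)"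
    using * int k nonneg by (simp add: nn_integral_eq_integral ennreal_mult')
  then have "abel_kernel \<beta> t\<^sub>0 * (LINT u|lborel. ?\<mu> u) \<le> abel_kernel \<beta> t\<^sub>1"
    by (simp add: abel_kernel_nonneg)
  also have "\<dots> < abel_kernel \<beta> t\<^sub>0 * 1" using k by simp
  finally show "(LINT u|lborel. ?\<mu> u) < 1"
    using k by (simp add: mult_less_cancel_left_pos)
qed

text \<open>The sweeping identity is integrated against \<open>w\<close> and the order of
  integration exchanged. Absolute integrability comes from the same identity, with \<open>u\<close>
  as inner variable and \<open>\<bar>w s\<bar>\<close> in place of \<open>w s\<close>. Sources at
  \<open>s \<ge> t\<^sub>0\<close> are invisible from every \<open>u < t\<^sub>0\<close>.\<close>

lemma balayage_convolution:
  assumes \<beta>: "0 < \<beta>" "\<beta> < 1" and t: "0 < t\<^sub>0" "t\<^sub>0 < t\<^sub>1"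
    and [measurable]: "w \<in> borel_measurable borel"
    and w0: "\<And>s. s < 0 \<Longrightarrow> w s = 0" and wB: "\<And>s. \<bar>w s\<bar> \<le> B"
  shows "integrable lborel (\<lambda>u. balayage \<beta> t\<^sub>0 t\<^sub>1 u * (LINT s|lborel. abel_kernel \<beta> (u - s) * w s))" (is ?int)
    and "(LINT s|lborel. indicator {..<t\<^sub>0} s * (abel_kernel \<beta> (t\<^sub>1 - s) * w s))
      = (LINT u|lborel. balayage \<beta> t\<^sub>0 t\<^sub>1 u * (LINT s|lborel. abel_kernel \<beta> (u - s) * w s))" (is ?eq)
proof -
  let ?\<mu> = "balayage \<beta> t\<^sub>0 t\<^sub>1"
  define f where "f = (\<lambda>s u. ?\<mu> u * abel_kernel \<beta> (u - s) * w s)"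
  have nonneg: "0 \<le> ?\<mu> u" for u
    using \<beta> t by (intro balayage_nonneg) auto
  have bal: "integrable lborel (\<lambda>u. ?\<mu> u * abel_kernel \<beta> (u - s)) \<and>
      (LINT u|lborel. ?\<mu> u * abel_kernel \<beta> (u - s)) = indicator {..<t\<^sub>0} s * abel_kernel \<beta> (t\<^sub>1 - s)" if "0 \<le> s" for s
  proof (cases "s < t\<^sub>0")
    case True
    have nn: "(\<integral>\<^sup>+u. ennreal (?\<mu> u * abel_kernel \<beta> (u - s)) \<partial>lborel) = ennreal (abel_kernel \<beta> (t\<^sub>1 - s))"
      using \<beta> t that True by (intro nn_integral_balayage_abel_kernel) auto
    have "has_bochner_integral lborel (\<lambda>u. ?\<mu> u * abel_kernel \<beta> (u - s)) (abel_kernel \<beta> (t\<^sub>1 - s))"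
      using nn by (intro has_bochner_integral_nn_integral) (auto simp: nonneg abel_kernel_nonneg)
    then show ?thesis using True by (simp add: has_bochner_integral_iff)
  next
    case False
    then have "(\<lambda>u. ?\<mu> u * abel_kernel \<beta> (u - s)) = (\<lambda>u. 0)"
      by (auto simp: fun_eq_iff balayage_def abel_kernel_def)
    then show ?thesis using False by simp
  qed
  have inner: "integrable lborel (f s) \<and> (LINT u|lborel. f s u) = indicator {..<t\<^sub>0} s * (abel_kernel \<beta> (t\<^sub>1 - s) * w s)
      \<and> (LINT u|lborel. norm (f s u)) = indicator {..<t\<^sub>0} s * (abel_kernel \<beta> (t\<^sub>1 - s) * \<bar>w s\<bar>)" for s
  proof (cases "0 \<le> s")
    case True
    have "norm (f s u) = ?\<mu> u * abel_kernel \<beta> (u - s) * \<bar>w s\<bar>" for u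
      by (simp add: f_def abs_mult nonneg abel_kernel_nonneg)
    then show ?thesis using bal[OF True] by (simp add: f_def)
  qed (simp add: f_def w0)
  have int1: "integrable lborel (\<lambda>s. abel_kernel \<beta> (t\<^sub>1 - s) * \<bar>w s\<bar>)"
    using \<beta> w0 wB by (intro integrable_abel_kernel_mult[of _ _ _ B]) auto
  have "integrable lborel (\<lambda>s. indicator {..<t\<^sub>0} s *\<^sub>R (abel_kernel \<beta> (t\<^sub>1 - s) * \<bar>w s\<bar>))"
    by (rule integrable_mult_indicator[OF _ int1]) simp
  then have pair: "integrable (lborel \<Otimes>\<^sub>M lborel) (case_prod f)"
    using inner by (intro lborel_pair.Fubini_integrable) (auto simp: f_def)
  have u: "(LINT s|lborel. f s u) = ?\<mu> u * (LINT s|lborel. abel_kernel \<beta> (u - s) * w s)" for u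
    by (simp add: f_def mult.assoc)
  show ?int
    using lborel_pair.integrable_snd[OF pair] by (simp add: u)
  show ?eq
    using lborel_pair.Fubini_integral[OF pair] inner by (simp add: u)
qed

text \<open>The source \<open>w\<close> is arbitrary apart from its sign where \<open>Z > m\<close>;
  the linear equation enters only in \<open>comparison\<close>. The maximum is taken over all of
  \<open>[0,T]\<close>, so it also dominates \<open>Z\<close> at the swept points before
  \<open>t\<^sub>0\<close>.\<close>

lemma max_principle:
  assumes \<beta>: "0 < \<beta>" "\<beta> < 1"
    and w[measurable]: "w \<in> borel_measurable borel"
    and w0: "\<And>s. s < 0 \<Longrightarrow> w s = 0" and wB: "\<And>s. \<bar>w s\<bar> \<le> B"
    and cont: "continuous_on {0..T} Z"
    and Z: "\<And>t. 0 \<le> t \<Longrightarrow> t \<le> T \<Longrightarrow> Z t = (LINT s|lborel. abel_kernel \<beta> (t - s) * w s)"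
    and m: "0 \<le> m"
    and sgn: "\<And>s. 0 \<le> s \<Longrightarrow> s \<le> T \<Longrightarrow> m < Z s \<Longrightarrow> w s \<le> 0"
    and t: "0 \<le> t" "t \<le> T"
  shows "Z t \<le> m"
proof (rule ccontr)
  assume "\<not> Z t \<le> m"
  obtain t\<^sub>1 where t1: "0 \<le> t\<^sub>1" "t\<^sub>1 \<le> T" and max: "\<And>s. 0 \<le> s \<Longrightarrow> s \<le> T \<Longrightarrow> Z s \<le> Z t\<^sub>1"
    using continuous_attains_sup[of "{0..T}" Z] cont t by auto
  have M: "m < Z t\<^sub>1"
    using max[of t] t \<open>\<not> Z t \<le> m\<close> by auto
  \<comment> \<open>As \<open>m \<ge> 0\<close>, this makes the set \<open>S\<close> below
    nonempty.\<close>
  have Z0: "Z 0 = 0"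
  proof -
    have "(\<lambda>s. abel_kernel \<beta> (0 - s) * w s) = (\<lambda>s. 0)"
      using w0 by (auto simp: fun_eq_iff abel_kernel_def)
    then show ?thesis using Z[of 0] t by simp
  qed
  define S where "S = {s \<in> {0..t\<^sub>1}. Z s \<le> m}"
  have "closed S"
  proof -
    have "continuous_on {0..t\<^sub>1} Z"
      using cont by (rule continuous_on_subset) (use t1 in auto)
    then have "closed ({0..t\<^sub>1} \<inter> Z -` {..m})"
      by (intro continuous_closed_preimage) auto
    moreover have "{0..t\<^sub>1} \<inter> Z -` {..m} = S" by (auto simp: S_def)
    ultimately show ?thesis by simp
  qed
  moreover have "0 \<in> S" using t1 Z0 m by (auto simp: S_def)
  moreover have bdd: "bdd_above S" by (auto simp: S_def bdd_above_def)
  ultimately have SupS: "Sup S \<in> S" by (intro closed_contains_Sup) auto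
  define t\<^sub>0 where "t\<^sub>0 = Sup S"
  have t0: "0 \<le> t\<^sub>0" "t\<^sub>0 \<le> t\<^sub>1" "Z t\<^sub>0 \<le> m"
    using SupS by (auto simp: S_def t\<^sub>0_def)
  have "t\<^sub>0 < t\<^sub>1" using t0 M by (cases "t\<^sub>0 = t\<^sub>1") auto
  have above: "m < Z s" if "t\<^sub>0 < s" "s \<le> t\<^sub>1" for s
  proof (rule ccontr)
    assume "\<not> m < Z s"
    then have "s \<in> S" using that t0 by (auto simp: S_def)
    then show False using cSup_upper[OF \<open>s \<in> S\<close> bdd] that by (simp add: t\<^sub>0_def)
  qed
  have int: "integrable lborel (\<lambda>s. abel_kernel \<beta> (t\<^sub>1 - s) * w s)"
    using \<beta> w0 wB by (intro integrable_abel_kernel_mult[of _ _ _ B]) auto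
  have int': "integrable lborel (\<lambda>s. indicator {..<t\<^sub>0} s * (abel_kernel \<beta> (t\<^sub>1 - s) * w s))"
    using integrable_mult_indicator[OF _ int, of "{..<t\<^sub>0}"] by simp
  have "Z t\<^sub>1 = (LINT s|lborel. abel_kernel \<beta> (t\<^sub>1 - s) * w s)"
    using Z t1 by simp
  \<comment> \<open>On \<open>(t\<^sub>0, t\<^sub>1]\<close> the source is nonpositive and beyond
    \<open>t\<^sub>1\<close> the kernel vanishes. At \<open>t\<^sub>0\<close> itself the sign of
    \<open>w\<close> is unknown, but this is a single point.\<close>
  also have "\<dots> \<le> (LINT s|lborel. indicator {..<t\<^sub>0} s * (abel_kernel \<beta> (t\<^sub>1 - s) * w s))"
  proof (rule integral_mono_AE[OF int int'])
    have "AE s in lborel. s \<noteq> t\<^sub>0" by (simp add: AE_lborel_singleton)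
    then show "AE s in lborel. abel_kernel \<beta> (t\<^sub>1 - s) * w s \<le> indicator {..<t\<^sub>0} s * (abel_kernel \<beta> (t\<^sub>1 - s) * w s)"
    proof eventually_elim
      case (elim s)
      show ?case
      proof (cases "t\<^sub>0 < s \<and> s \<le> t\<^sub>1")
        case True
        then have "w s \<le> 0" using sgn[of s] above[of s] t0 t1 by auto
        then show ?thesis using True by (simp add: mult_nonneg_nonpos abel_kernel_nonneg)
      qed (use elim in \<open>auto simp: abel_kernel_def indicator_def\<close>)
    qed
  qed
  finally have le: "Z t\<^sub>1 \<le> (LINT s|lborel. indicator {..<t\<^sub>0} s * (abel_kernel \<beta> (t\<^sub>1 - s) * w s))" .
  show False
  proof (cases "t\<^sub>0 = 0")
    \<comment> \<open>Nothing is left to sweep: \<open>w\<close> vanishes at negative times, so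
      \<open>Z t\<^sub>1 \<le> 0 \<le> m\<close>.\<close>
    case True
    then have "(\<lambda>s. indicator {..<t\<^sub>0} s * (abel_kernel \<beta> (t\<^sub>1 - s) * w s)) = (\<lambda>s. 0)"
      using w0 by (auto simp: fun_eq_iff indicator_def)
    then show False using le M m by simp
  next
    case False
    with t0 have "0 < t\<^sub>0" by simp
    note bal = balayage_convolution[OF \<beta> \<open>0 < t\<^sub>0\<close> \<open>t\<^sub>0 < t\<^sub>1\<close> w w0 wB]
    note mass = balayage_mass[OF \<beta> \<open>0 < t\<^sub>0\<close> \<open>t\<^sub>0 < t\<^sub>1\<close>]
    have "Z t\<^sub>1 \<le> (LINT u|lborel. balayage \<beta> t\<^sub>0 t\<^sub>1 u * (LINT s|lborel. abel_kernel \<beta> (u - s) * w s))"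
      using le bal by simp
    also have "\<dots> \<le> (LINT u|lborel. balayage \<beta> t\<^sub>0 t\<^sub>1 u * Z t\<^sub>1)"
    proof (rule integral_mono[OF bal(1)])
      show "integrable lborel (\<lambda>u. balayage \<beta> t\<^sub>0 t\<^sub>1 u * Z t\<^sub>1)" using mass by simp
      fix u
      show "balayage \<beta> t\<^sub>0 t\<^sub>1 u * (LINT s|lborel. abel_kernel \<beta> (u - s) * w s) \<le> balayage \<beta> t\<^sub>0 t\<^sub>1 u * Z t\<^sub>1"
      proof (cases "0 < u \<and> u < t\<^sub>0")
        case True
        then have "(LINT s|lborel. abel_kernel \<beta> (u - s) * w s) \<le> Z t\<^sub>1"
          using Z[of u] max[of u] t0 t1 by auto
        then show ?thesis
          using balayage_nonneg[of \<beta> t\<^sub>0 t\<^sub>1 u] \<beta> \<open>t\<^sub>0 < t\<^sub>1\<close> by (simp add: mult_left_mono)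
      qed (auto simp: balayage_def)
    qed
    also have "\<dots> = (LINT u|lborel. balayage \<beta> t\<^sub>0 t\<^sub>1 u) * Z t\<^sub>1"
      by simp
    \<comment> \<open>The mass is below \<open>1\<close> and \<open>Z t\<^sub>1 > m \<ge> 0\<close>,
      so \<open>Z t\<^sub>1\<close> would be strictly less than itself.\<close>
    also have "\<dots> < 1 * Z t\<^sub>1"
      using mass M m by (intro mult_strict_right_mono) auto
    finally show False by simp
  qed
qed

subsection \<open>Existence of solutions by contraction in a weighted norm\<close>

text \<open>This is the Laplace transform of the kernel, from the Gamma integral by the scaling
  \<open>t \<mapsto> \<sigma> * t\<close>. Its decay in \<open>\<sigma>\<close> is what makes the
  weighted operator a contraction.\<close>

lemma abel_kernel_exp_integral:
  assumes "0 < \<beta>" "0 < \<sigma>"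
  shows "integrable lborel (\<lambda>s. abel_kernel \<beta> s * exp (- (\<sigma> * s)))"
    and "(LINT s|lborel. abel_kernel \<beta> s * exp (- (\<sigma> * s))) = Gamma \<beta> / \<sigma> powr \<beta>"
proof -
  let ?q = "\<lambda>s. abel_kernel \<beta> s * exp (- (\<sigma> * s))"
  have "ennreal (Gamma \<beta>) = ennreal \<sigma> * (\<integral>\<^sup>+t. ennreal (indicator {0..} (\<sigma> * t) * (\<sigma> * t) powr (\<beta> - 1) / exp (\<sigma> * t)) \<partial>lborel)"
    using assms Gamma_conv_nn_integral_real[of \<beta>]
    by (subst (asm) nn_integral_real_affine[where c = \<sigma> and t = 0]) auto
  also have "\<dots> = (\<integral>\<^sup>+t. ennreal \<sigma> * ennreal (indicator {0..} (\<sigma> * t) * (\<sigma> * t) powr (\<beta> - 1) / exp (\<sigma> * t)) \<partial>lborel)"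
    by (rule nn_integral_cmult[symmetric]) measurable
  also have "\<dots> = (\<integral>\<^sup>+t. ennreal (\<sigma> powr \<beta> * ?q t) \<partial>lborel)"
  proof (rule nn_integral_cong)
    fix t
    show "ennreal \<sigma> * ennreal (indicator {0..} (\<sigma> * t) * (\<sigma> * t) powr (\<beta> - 1) / exp (\<sigma> * t)) = ennreal (\<sigma> powr \<beta> * ?q t)"
    proof (cases "0 < t")
      case True
      then have "\<sigma> * (indicator {0..} (\<sigma> * t) * (\<sigma> * t) powr (\<beta> - 1) / exp (\<sigma> * t)) = \<sigma> powr \<beta> * ?q t"
        using assms by (simp add: abel_kernel_def powr_mult powr_diff exp_minus field_simps)
      then show ?thesis using assms by (simp flip: ennreal_mult')
    next
      case False
      then have "t = 0 \<or> \<sigma> * t < 0" using assms by (auto simp: mult_less_0_iff)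
      then show ?thesis using False by (auto simp: abel_kernel_def)
    qed
  qed
  finally have "(\<integral>\<^sup>+t. ennreal (\<sigma> powr \<beta> * ?q t) \<partial>lborel) = ennreal (Gamma \<beta>)" by simp
  then have "has_bochner_integral lborel (\<lambda>t. \<sigma> powr \<beta> * ?q t) (Gamma \<beta>)"
    using assms by (intro has_bochner_integral_nn_integral) (auto simp: abel_kernel_nonneg Gamma_real_pos less_imp_le)
  then have *: "has_bochner_integral lborel (\<lambda>t. 1 / \<sigma> powr \<beta> * (\<sigma> powr \<beta> * ?q t)) (1 / \<sigma> powr \<beta> * Gamma \<beta>)"
    by (rule has_bochner_integral_mult_right)
  then show "integrable lborel ?q" "(LINT s|lborel. ?q s) = Gamma \<beta> / \<sigma> powr \<beta>"
    using assms by (simp_all add: has_bochner_integral_iff)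
qed

lemma integrable_convolution_bounded:
  fixes q f :: "real \<Rightarrow> real"
  assumes q: "integrable lborel q" and [measurable]: "f \<in> borel_measurable borel"
    and B: "\<And>x. \<bar>f x\<bar> \<le> B"
  shows "integrable lborel (\<lambda>s. q s * f (t - s))"
proof (rule Bochner_Integration.integrable_bound)
  have [measurable]: "q \<in> borel_measurable borel" using q by auto
  show "(\<lambda>s. q s * f (t - s)) \<in> borel_measurable lborel" by measurable
  show "integrable lborel (\<lambda>s. B * q s)" using q by simp
  have "\<bar>f x\<bar> \<le> \<bar>B\<bar>" for x using B[of x] by linarith
  then show "AE s in lborel. norm (q s * f (t - s)) \<le> norm (B * q s)"
    by (intro AE_I2) (simp add: abs_mult mult.commute[of "\<bar>B\<bar>"] mult_left_mono)
qed

text \<open>A jump of \<open>f\<close> at \<open>a\<close> is allowed, since a function cut off at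
  time \<open>0\<close> will be inserted. For each \<open>t\<close> it affects only
  \<open>s = t - a\<close>, so dominated convergence still applies.\<close>

lemma continuous_on_convolution:
  fixes q f :: "real \<Rightarrow> real"
  assumes q: "integrable lborel q" and [measurable]: "f \<in> borel_measurable borel"
    and B: "\<And>x. \<bar>f x\<bar> \<le> B" and cont: "\<And>x. x \<noteq> a \<Longrightarrow> isCont f x"
  shows "continuous_on UNIV (\<lambda>t. LINT s|lborel. q s * f (t - s))"
proof (rule continuous_at_imp_continuous_on, rule ballI)
  fix t :: real
  have [measurable]: "q \<in> borel_measurable borel" using q by auto
  show "isCont (\<lambda>t. LINT s|lborel. q s * f (t - s)) t"
  proof (rule continuous_at_sequentiallyI)
    fix x :: "nat \<Rightarrow> real"
    assume x: "x \<longlonglongrightarrow> t"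
    show "(\<lambda>n. LINT s|lborel. q s * f (x n - s)) \<longlonglongrightarrow> (LINT s|lborel. q s * f (t - s))"
    proof (rule integral_dominated_convergence[where w = "\<lambda>s. \<bar>B\<bar> * \<bar>q s\<bar>"])
      show "integrable lborel (\<lambda>s. \<bar>B\<bar> * \<bar>q s\<bar>)" using q by simp
      have "AE s in lborel. s \<noteq> t - a" by (simp add: AE_lborel_singleton)
      then show "AE s in lborel. (\<lambda>n. q s * f (x n - s)) \<longlonglongrightarrow> q s * f (t - s)"
      proof eventually_elim
        case (elim s)
        then have "isCont f (t - s)" by (intro cont) auto
        moreover have "(\<lambda>n. x n - s) \<longlonglongrightarrow> t - s" using x by (intro tendsto_intros)
        ultimately have "(\<lambda>n. f (x n - s)) \<longlonglongrightarrow> f (t - s)" by (rule isCont_tendsto_compose)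
        then show ?case by (intro tendsto_intros)
      qed
      have "\<bar>f y\<bar> \<le> \<bar>B\<bar>" for y using B[of y] by linarith
      then show "AE s in lborel. norm (q s * f (x n - s)) \<le> \<bar>B\<bar> * \<bar>q s\<bar>" for n
        by (intro AE_I2) (simp add: abs_mult mult.commute[of "\<bar>B\<bar>"] mult_left_mono)
    qed measurable
  qed
qed

text \<open>
  The unknown is \<open>u(t) = exp (- \<sigma> t) Y(t)\<close>, for which the integral operator has norm
  \<open>|\<kappa>| / \<sigma>\<^sup>\<beta>\<close>. Values at negative times only serve to make \<open>u\<close> continuous on the whole line.
\<close>

lemma ex_linear_solution_bounded:
  fixes \<beta> \<kappa> :: real and \<xi> :: "real \<Rightarrow> real"
  assumes \<beta>: "0 < \<beta>" and \<xi>: "continuous_on UNIV \<xi>" "bounded (range \<xi>)"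
  shows "\<exists>Y. continuous_on UNIV Y \<and>
    (\<forall>t\<ge>0. Y t = \<xi> t + \<kappa> / Gamma \<beta> * (LINT s|lborel. abel_kernel \<beta> (t - s) * (indicator {0..} s * Y s)))"
proof -
  \<comment> \<open>This choice gives the contraction factor \<open>\<bar>\<kappa>\<bar> / (2 *
    \<bar>\<kappa>\<bar> + 1) \<le> 1 / 2\<close>.\<close>
  define \<sigma> where "\<sigma> = (2 * \<bar>\<kappa>\<bar> + 1) powr (1 / \<beta>)"
  have \<sigma>: "0 < \<sigma>" "\<sigma> powr \<beta> = 2 * \<bar>\<kappa>\<bar> + 1"
    using \<beta> by (auto simp: \<sigma>_def powr_powr)
  have \<Gamma>: "0 < Gamma \<beta>" using \<beta> by (simp add: Gamma_real_pos)
  define q where "q = (\<lambda>s. abel_kernel \<beta> s * exp (- (\<sigma> * s)))"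
  have q: "integrable lborel q" "(LINT s|lborel. q s) = Gamma \<beta> / \<sigma> powr \<beta>"
    unfolding q_def by (rule abel_kernel_exp_integral[OF \<beta> \<sigma>(1)])+
  have q_nonneg: "0 \<le> q s" for s by (simp add: q_def abel_kernel_nonneg)
  define f where "f = (\<lambda>(u :: real \<Rightarrow>\<^sub>C real) s. indicator {0..} s * u s)"
  define \<Phi> where "\<Phi> = (\<lambda>(u :: real \<Rightarrow>\<^sub>C real) t. exp (- (\<sigma> * max 0 t)) * \<xi> (max 0 t)
     + \<kappa> / Gamma \<beta> * (LINT s|lborel. q s * f u (t - s)))"
  have f_meas [measurable]: "f u \<in> borel_measurable borel" for u
    unfolding f_def
    by (intro borel_measurable_times borel_measurable_indicator borel_measurable_continuous_onI) auto
  obtain b where b: "\<And>(u :: real \<Rightarrow>\<^sub>C real) x. \<bar>f u x\<bar> \<le> b u"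
  proof -
    have "\<exists>b. \<forall>x. \<bar>f u x\<bar> \<le> b" for u :: "real \<Rightarrow>\<^sub>C real"
    proof -
      obtain b where "\<forall>x. \<bar>u x\<bar> \<le> b"
        using bounded_apply_bcontfun[of u] by (auto simp: bounded_iff)
      moreover have "\<bar>f u x\<bar> \<le> \<bar>u x\<bar>" for x by (auto simp: f_def indicator_def)
      ultimately show ?thesis by (meson order_trans)
    qed
    then show ?thesis using that by metis
  qed
  have f_cont: "isCont (f u) x" if "x \<noteq> 0" for u x
  proof -
    have "isCont u x"
      using continuous_on_apply_bcontfun[of UNIV u] continuous_on_eq_continuous_at[OF open_UNIV] by blast
    moreover have "isCont (indicator {0..} :: real \<Rightarrow> real) x"
      using that by (simp add: isCont_indicator)
    ultimately show ?thesis unfolding f_def by (intro continuous_intros)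
  qed
  have conv_int: "integrable lborel (\<lambda>s. q s * f u (t - s))" for u t
    by (rule integrable_convolution_bounded[OF q(1) f_meas b])
  obtain K where K: "\<And>x. \<bar>\<xi> x\<bar> \<le> K" using \<xi>(2) by (auto simp: bounded_iff)
  have \<Phi>_mem: "\<Phi> u \<in> bcontfun" for u
  proof -
    have 1: "continuous_on UNIV (\<lambda>t. exp (- (\<sigma> * max 0 t)) * \<xi> (max 0 t))"
      by (intro continuous_intros continuous_on_compose2[OF \<xi>(1)]) auto
    have 2: "continuous_on UNIV (\<lambda>t. LINT s|lborel. q s * f u (t - s))"
      by (rule continuous_on_convolution[OF q(1) f_meas b f_cont])
    have "\<bar>\<Phi> u t\<bar> \<le> K + \<bar>\<kappa> / Gamma \<beta>\<bar> * (LINT s|lborel. q s * b u)" for t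
    proof -
      have "\<bar>exp (- (\<sigma> * max 0 t)) * \<xi> (max 0 t)\<bar> \<le> 1 * K"
        unfolding abs_mult using \<sigma> K by (intro mult_mono) auto
      moreover have "\<bar>LINT s|lborel. q s * f u (t - s)\<bar> \<le> (LINT s|lborel. q s * b u)"
        using q b q_nonneg by (intro integral_abs_bound_integral conv_int) (auto simp: abs_mult intro!: mult_left_mono)
      then have "\<bar>\<kappa> / Gamma \<beta> * (LINT s|lborel. q s * f u (t - s))\<bar> \<le> \<bar>\<kappa> / Gamma \<beta>\<bar> * (LINT s|lborel. q s * b u)"
        unfolding abs_mult by (intro mult_left_mono) auto
      ultimately show ?thesis unfolding \<Phi>_def by linarith
    qed
    then have "bounded (range (\<Phi> u))" by (auto simp: bounded_iff)
    moreover have "continuous_on UNIV (\<Phi> u)"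
      unfolding \<Phi>_def by (intro continuous_intros 1 2)
    ultimately show ?thesis by (simp add: bcontfun_def)
  qed
  define F where "F = (\<lambda>u. Bcontfun (\<Phi> u))"
  have F: "apply_bcontfun (F u) = \<Phi> u" for u
    unfolding F_def by (rule Bcontfun_inverse[OF \<Phi>_mem])
  have "\<exists>!u. F u = u"
  proof (rule banach_fix_type[where c = "1 / 2"], simp, simp, intro allI)
    fix u v :: "real \<Rightarrow>\<^sub>C real"
    show "dist (F u) (F v) \<le> 1 / 2 * dist u v"
    proof (rule dist_bound)
      fix t
      have "\<Phi> u t - \<Phi> v t = \<kappa> / Gamma \<beta> * (LINT s|lborel. q s * f u (t - s) - q s * f v (t - s))"
        unfolding \<Phi>_def by (subst Bochner_Integration.integral_diff[OF conv_int conv_int]) (simp add: algebra_simps)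
      moreover have "\<bar>LINT s|lborel. q s * f u (t - s) - q s * f v (t - s)\<bar> \<le> (LINT s|lborel. q s * dist u v)"
      proof (rule integral_abs_bound_integral)
        fix s
        have "\<bar>f u (t - s) - f v (t - s)\<bar> \<le> dist u v"
          using dist_bounded[of u "t - s" v] by (auto simp: f_def indicator_def dist_real_def)
        then show "\<bar>q s * f u (t - s) - q s * f v (t - s)\<bar> \<le> q s * dist u v"
          using q_nonneg[of s] by (simp add: abs_mult flip: right_diff_distrib) (rule mult_left_mono)
      qed (use conv_int q in auto)
      ultimately have "\<bar>\<Phi> u t - \<Phi> v t\<bar> \<le> \<bar>\<kappa> / Gamma \<beta>\<bar> * (LINT s|lborel. q s * dist u v)"
        by (simp only: abs_mult) (intro mult_left_mono; simp)
      also have "\<dots> = \<bar>\<kappa> / Gamma \<beta>\<bar> * (Gamma \<beta> / \<sigma> powr \<beta> * dist u v)"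
        by (simp add: q)
      also have "\<dots> = \<bar>\<kappa>\<bar> / (2 * \<bar>\<kappa>\<bar> + 1) * dist u v"
        using \<Gamma> \<sigma> by simp
      also have "\<dots> \<le> 1 / 2 * dist u v"
        by (intro mult_right_mono) (auto simp: divide_simps)
      finally show "dist (F u t) (F v t) \<le> 1 / 2 * dist u v"
        by (simp add: F dist_real_def)
    qed
  qed
  then obtain u where u: "F u = u" by auto
  define Y where "Y = (\<lambda>t. exp (\<sigma> * t) * u t)"
  have "Y t = \<xi> t + \<kappa> / Gamma \<beta> * (LINT s|lborel. abel_kernel \<beta> (t - s) * (indicator {0..} s * Y s))" if "0 \<le> t" for t
  proof -
    have "(LINT s|lborel. q s * f u (t - s)) = (LINT s|lborel. q (t - s) * f u s)"
      by (subst lborel_integral_real_affine[where c = "-1" and t = t]) auto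
    then have "exp (\<sigma> * t) * (LINT s|lborel. q s * f u (t - s)) = (LINT s|lborel. exp (\<sigma> * t) * (q (t - s) * f u s))"
      by simp
    \<comment> \<open>The weight passes through the kernel:
      \<open>exp (\<sigma> * t) * q (t - s)\<close> equals
      \<open>abel_kernel \<beta> (t - s) * exp (\<sigma> * s)\<close>, and the last factor turns
      \<open>u\<close> into \<open>Y\<close>.\<close>
    also have "\<dots> = (LINT s|lborel. abel_kernel \<beta> (t - s) * (indicator {0..} s * Y s))"
      by (rule Bochner_Integration.integral_cong) (auto simp: q_def f_def Y_def exp_minus exp_diff field_simps)
    finally have *: "exp (\<sigma> * t) * (LINT s|lborel. q s * f u (t - s)) = (LINT s|lborel. abel_kernel \<beta> (t - s) * (indicator {0..} s * Y s))" .
    have "Y t = exp (\<sigma> * t) * \<Phi> u t" unfolding Y_def F[symmetric] u ..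
    also have "\<dots> = \<xi> t + \<kappa> / Gamma \<beta> * (exp (\<sigma> * t) * (LINT s|lborel. q s * f u (t - s)))"
      using that by (simp add: \<Phi>_def algebra_simps exp_minus)
    finally show ?thesis unfolding * .
  qed
  moreover have "continuous_on UNIV Y" unfolding Y_def by (intro continuous_intros) auto
  ultimately show ?thesis by blast
qed

subsection \<open>Fractional integrals and the linear equation\<close>

text \<open>The Riemann-Liouville integral of order \<open>\<beta>\<close> is written over the whole
  line: the indicator cuts at \<open>0\<close> and the kernel at \<open>t\<close>. Algebraic rules
  then reduce to equalities of integrands.\<close>

definition frac_integrable :: "real \<Rightarrow> (real \<Rightarrow> real) \<Rightarrow> real \<Rightarrow> bool" where
  "frac_integrable \<beta> f t \<longleftrightarrow> integrable lborel (\<lambda>s. abel_kernel \<beta> (t - s) * (indicator {0..} s * f s))"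

definition frac_integral :: "real \<Rightarrow> (real \<Rightarrow> real) \<Rightarrow> real \<Rightarrow> real" where
  "frac_integral \<beta> f t = 1 / Gamma \<beta> * (LINT s|lborel. abel_kernel \<beta> (t - s) * (indicator {0..} s * f s))"

lemma frac_integral_set_integral:
  "set_integrable lborel {0..t} (\<lambda>s. (t - s) powr (\<beta> - 1) * f s) \<longleftrightarrow> frac_integrable \<beta> f t"
  "1 / Gamma \<beta> * (LBINT s:{0..t}. (t - s) powr (\<beta> - 1) * f s) = frac_integral \<beta> f t"
proof -
  have *: "(\<lambda>s. indicator {0..t} s *\<^sub>R ((t - s) powr (\<beta> - 1) * f s)) = (\<lambda>s. abel_kernel \<beta> (t - s) * (indicator {0..} s * f s))"
    by (auto simp: fun_eq_iff abel_kernel_def indicator_def)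
  show "set_integrable lborel {0..t} (\<lambda>s. (t - s) powr (\<beta> - 1) * f s) \<longleftrightarrow> frac_integrable \<beta> f t"
    "1 / Gamma \<beta> * (LBINT s:{0..t}. (t - s) powr (\<beta> - 1) * f s) = frac_integral \<beta> f t"
    unfolding set_integrable_def set_lebesgue_integral_def frac_integrable_def frac_integral_def * by (rule refl)+
qed

lemma continuous_solution_iff:
  "continuous_solution \<beta> F \<xi> X \<longleftrightarrow> continuous_on {0..} X \<and>
    (\<forall>t\<ge>0. frac_integrable \<beta> (\<lambda>s. F (X s)) t \<and> X t = \<xi> t + frac_integral \<beta> (\<lambda>s. F (X s)) t)"
  unfolding continuous_solution_def frac_integral_set_integral ..

lemma frac_integral_diff:
  assumes "frac_integrable \<beta> f t" "frac_integrable \<beta> g t"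
  shows "frac_integrable \<beta> (\<lambda>s. f s - g s) t" "frac_integral \<beta> (\<lambda>s. f s - g s) t = frac_integral \<beta> f t - frac_integral \<beta> g t"
proof -
  have *: "(\<lambda>s. abel_kernel \<beta> (t - s) * (indicator {0..} s * (f s - g s))) =
    (\<lambda>s. abel_kernel \<beta> (t - s) * (indicator {0..} s * f s) - abel_kernel \<beta> (t - s) * (indicator {0..} s * g s))"
    by (simp add: fun_eq_iff algebra_simps)
  show "frac_integrable \<beta> (\<lambda>s. f s - g s) t" "frac_integral \<beta> (\<lambda>s. f s - g s) t = frac_integral \<beta> f t - frac_integral \<beta> g t"
    using assms unfolding frac_integrable_def frac_integral_def *
    by (simp_all only: Bochner_Integration.integrable_diff Bochner_Integration.integral_diff right_diff_distrib)
qed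

lemma frac_integral_cmult:
  shows "frac_integrable \<beta> f t \<Longrightarrow> frac_integrable \<beta> (\<lambda>s. c * f s) t"
    and "frac_integral \<beta> (\<lambda>s. c * f s) t = c * frac_integral \<beta> f t"
proof -
  have *: "(\<lambda>s. abel_kernel \<beta> (t - s) * (indicator {0..} s * (c * f s))) = (\<lambda>s. c * (abel_kernel \<beta> (t - s) * (indicator {0..} s * f s)))"
    by (simp add: fun_eq_iff)
  show "frac_integrable \<beta> f t \<Longrightarrow> frac_integrable \<beta> (\<lambda>s. c * f s) t"
    "frac_integral \<beta> (\<lambda>s. c * f s) t = c * frac_integral \<beta> f t"
    unfolding frac_integrable_def frac_integral_def * by simp_all
qed

lemma frac_integral_cong:
  assumes "\<And>s. 0 \<le> s \<Longrightarrow> s \<le> t \<Longrightarrow> f s = g s"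
  shows "frac_integrable \<beta> f t = frac_integrable \<beta> g t" "frac_integral \<beta> f t = frac_integral \<beta> g t"
proof -
  have *: "(\<lambda>s. abel_kernel \<beta> (t - s) * (indicator {0..} s * f s)) = (\<lambda>s. abel_kernel \<beta> (t - s) * (indicator {0..} s * g s))"
    using assms by (auto simp: fun_eq_iff abel_kernel_def indicator_def)
  show "frac_integrable \<beta> f t = frac_integrable \<beta> g t" "frac_integral \<beta> f t = frac_integral \<beta> g t"
    unfolding frac_integrable_def frac_integral_def * by (rule refl)+
qed

lemma continuous_on_Icc_bounded:
  fixes f :: "real \<Rightarrow> real"
  assumes "continuous_on {a..b} f"
  obtains B where "\<And>s. a \<le> s \<Longrightarrow> s \<le> b \<Longrightarrow> \<bar>f s\<bar> \<le> B"
proof -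
  have "bounded (f ` {a..b})"
    by (intro compact_imp_bounded compact_continuous_image assms) auto
  then obtain B where B: "\<forall>s\<in>{a..b}. \<bar>f s\<bar> \<le> B" by (auto simp: bounded_iff)
  show ?thesis by (rule that[of B]) (use B in auto)
qed

lemma frac_integrable_bounded:
  assumes "0 < \<beta>" "set_borel_measurable borel {0..} f" "\<And>s. 0 \<le> s \<Longrightarrow> s \<le> t \<Longrightarrow> \<bar>f s\<bar> \<le> B"
  shows "frac_integrable \<beta> f t"
  unfolding frac_integrable_def
  using assms by (intro integrable_abel_kernel_mult[of _ _ _ B]) (auto simp: set_borel_measurable_def)

lemma frac_integrable_continuous:
  assumes "0 < \<beta>" "continuous_on {0..} f"
  shows "frac_integrable \<beta> f t"
proof -
  obtain B where "\<And>s. 0 \<le> s \<Longrightarrow> s \<le> t \<Longrightarrow> \<bar>f s\<bar> \<le> B"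
    using continuous_on_Icc_bounded[OF continuous_on_subset[OF assms(2)], of 0 t] by auto
  moreover have "set_borel_measurable borel {0..} f"
    unfolding set_borel_measurable_def by (intro borel_measurable_continuous_on_indicator assms) auto
  ultimately show ?thesis using assms by (intro frac_integrable_bounded) auto
qed

text \<open>Apply \<open>max_principle\<close> to \<open>(g - l * Z) / Gamma \<beta>\<close>: where
  \<open>Z > m\<close>, \<open>g \<le> l * m \<le> l * Z\<close>. Cutting the source off after
  \<open>T\<close> makes it globally bounded and leaves \<open>Z\<close> on \<open>[0,T]\<close>
  unchanged. \<open>B\<close> supplies the lower bound on \<open>g\<close>.\<close>

lemma comparison:
  assumes \<beta>: "0 < \<beta>" "\<beta> < 1" and l: "0 \<le> l"
    and g: "set_borel_measurable borel {0..} g" and gB: "\<And>s. 0 \<le> s \<Longrightarrow> s \<le> T \<Longrightarrow> \<bar>g s\<bar> \<le> B"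
    and cont: "continuous_on {0..T} Z"
    and Z: "\<And>t. 0 \<le> t \<Longrightarrow> t \<le> T \<Longrightarrow> Z t = frac_integral \<beta> (\<lambda>s. g s - l * Z s) t"
    and m: "0 \<le> m" and gm: "\<And>s. 0 \<le> s \<Longrightarrow> s \<le> T \<Longrightarrow> g s \<le> l * m"
    and t: "0 \<le> t" "t \<le> T"
  shows "Z t \<le> m"
proof -
  define w where "w = (\<lambda>s. 1 / Gamma \<beta> * (indicator {0..T} s * (g s - l * Z s)))"
  have \<Gamma>: "0 < Gamma \<beta>" using \<beta> by (simp add: Gamma_real_pos)
  obtain K where K: "\<And>s. 0 \<le> s \<Longrightarrow> s \<le> T \<Longrightarrow> \<bar>Z s\<bar> \<le> K"
    using continuous_on_Icc_bounded[OF cont] by blast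
  show ?thesis
  proof (rule max_principle[OF \<beta>, of w "1 / Gamma \<beta> * (B + l * K)" T Z])
    have [measurable]: "(\<lambda>s. indicator {0..} s * g s) \<in> borel_measurable borel"
      using g by (simp add: set_borel_measurable_def)
    have [measurable]: "(\<lambda>s. indicator {0..T} s *\<^sub>R Z s) \<in> borel_measurable borel"
      using cont by (intro borel_measurable_continuous_on_indicator) auto
    have "w = (\<lambda>s. 1 / Gamma \<beta> * (indicator {0..T} s * (indicator {0..} s * g s) - l * (indicator {0..T} s *\<^sub>R Z s)))"
      by (auto simp: w_def fun_eq_iff indicator_def)
    also have "\<dots> \<in> borel_measurable borel" by measurable
    finally show "w \<in> borel_measurable borel" .
    show "w s = 0" if "s < 0" for s using that by (simp add: w_def)
    show "\<bar>w s\<bar> \<le> 1 / Gamma \<beta> * (B + l * K)" for s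
    proof -
      have "\<bar>indicator {0..T} s * (g s - l * Z s)\<bar> \<le> B + l * K"
      proof (cases "s \<in> {0..T}")
        case True
        then have "\<bar>l * Z s\<bar> \<le> l * K" using K[of s] l by (simp add: abs_mult mult_left_mono)
        then show ?thesis using gB[of s] True by simp
      next
        case False
        have "0 \<le> B" "0 \<le> K" using gB[of t] K[of t] t by auto
        then show ?thesis using False l by simp
      qed
      then show ?thesis unfolding w_def abs_mult using \<Gamma> by (simp add: divide_right_mono)
    qed
    show "Z t = (LINT s|lborel. abel_kernel \<beta> (t - s) * w s)" if "0 \<le> t" "t \<le> T" for t
    proof -
      have "abel_kernel \<beta> (t - s) * w s = 1 / Gamma \<beta> * (abel_kernel \<beta> (t - s) * (indicator {0..} s * (g s - l * Z s)))" for s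
        using that by (auto simp: abel_kernel_def w_def indicator_def)
      then show ?thesis using Z[OF that] by (simp add: frac_integral_def)
    qed
    show "w s \<le> 0" if "0 \<le> s" "s \<le> T" "m < Z s" for s
    proof -
      have "l * m \<le> l * Z s" using that l by (simp add: mult_left_mono)
      then have "g s - l * Z s \<le> 0" using gm[of s] that by linarith
      then show ?thesis using \<Gamma> that by (auto simp: w_def divide_le_0_iff)
    qed
  qed (use cont m t in auto)
qed

lemma comparison_abs:
  assumes \<beta>: "0 < \<beta>" "\<beta> < 1" and l: "0 \<le> l"
    and g: "set_borel_measurable borel {0..} g"
    and cont: "continuous_on {0..T} Z"
    and Z: "\<And>t. 0 \<le> t \<Longrightarrow> t \<le> T \<Longrightarrow> Z t = frac_integral \<beta> (\<lambda>s. g s - l * Z s) t"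
    and m: "0 \<le> m" and gm: "\<And>s. 0 \<le> s \<Longrightarrow> s \<le> T \<Longrightarrow> \<bar>g s\<bar> \<le> l * m"
    and t: "0 \<le> t" "t \<le> T"
  shows "\<bar>Z t\<bar> \<le> m"
proof -
  have "Z t \<le> m"
    using gm by (intro comparison[OF \<beta> l g _ cont Z m _ t, where B = "l * m"]) (auto intro: order_trans[OF abs_ge_self])
  moreover have "- Z t \<le> m"
  proof (rule comparison[OF \<beta> l, where T = T and g = "\<lambda>s. - g s" and B = "l * m" and Z = "\<lambda>t. - Z t"])
    show "set_borel_measurable borel {0..} (\<lambda>s. - g s)"
      using g by (simp add: set_borel_measurable_def)
    show "- Z t = frac_integral \<beta> (\<lambda>s. - g s - l * - Z s) t" if "0 \<le> t" "t \<le> T" for t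
      using Z[OF that] frac_integral_cmult(2)[of \<beta> "-1" "\<lambda>s. g s - l * Z s" t] by (simp add: algebra_simps)
    show "- g s \<le> l * m" "\<bar>- g s\<bar> \<le> l * m" if "0 \<le> s" "s \<le> T" for s
      using gm[OF that] by auto
  qed (use cont m t in \<open>auto intro!: continuous_intros\<close>)
  ultimately show ?thesis by linarith
qed

text \<open>The difference has source \<open>0\<close>, so comparison applies with
  \<open>m = 0\<close>. Both equations are assumed only up to \<open>T\<close>, which allows the
  gluing in \<open>ex_linear_solution\<close>.\<close>

lemma linear_unique:
  assumes \<beta>: "0 < \<beta>" "\<beta> < 1" and l: "0 \<le> l"
    and cont: "continuous_on {0..} Y" "continuous_on {0..} Y'"
    and Y: "\<And>t. 0 \<le> t \<Longrightarrow> t \<le> T \<Longrightarrow> Y t = \<xi> t + frac_integral \<beta> (\<lambda>s. - l * Y s) t"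
    and Y': "\<And>t. 0 \<le> t \<Longrightarrow> t \<le> T \<Longrightarrow> Y' t = \<xi> t + frac_integral \<beta> (\<lambda>s. - l * Y' s) t"
    and t: "0 \<le> t" "t \<le> T"
  shows "Y t = Y' t"
proof -
  have "\<bar>Y t - Y' t\<bar> \<le> 0"
  proof (rule comparison_abs[OF \<beta> l, where g = "\<lambda>s. 0" and T = T and Z = "\<lambda>t. Y t - Y' t"])
    show "continuous_on {0..T} (\<lambda>t. Y t - Y' t)"
      by (intro continuous_intros continuous_on_subset[OF cont(1)] continuous_on_subset[OF cont(2)]) auto
    show "Y t - Y' t = frac_integral \<beta> (\<lambda>s. 0 - l * (Y s - Y' s)) t" if "0 \<le> t" "t \<le> T" for t
    proof -
      have "frac_integral \<beta> (\<lambda>s. - l * Y s - - l * Y' s) t = frac_integral \<beta> (\<lambda>s. - l * Y s) t - frac_integral \<beta> (\<lambda>s. - l * Y' s) t"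
        by (intro frac_integral_diff frac_integrable_continuous continuous_intros \<beta> cont)
      then show ?thesis using Y[OF that] Y'[OF that] by (simp add: algebra_simps)
    qed
  qed (use t in \<open>auto simp: set_borel_measurable_def\<close>)
  then show ?thesis by simp
qed

lemma ex_linear_solution:
  assumes \<beta>: "0 < \<beta>" "\<beta> < 1" and l: "0 \<le> l" and \<xi>: "continuous_on {0..} \<xi>"
  shows "\<exists>Y. continuous_solution \<beta> (\<lambda>x. - l * x) \<xi> Y"
proof -
  \<comment> \<open>Clamping the argument to \<open>[0,n]\<close> makes the datum continuous on the
    whole line and bounded.\<close>
  define \<xi>' where "\<xi>' = (\<lambda>n t. \<xi> (max 0 (min (real n) t)))"
  have "\<exists>Y. continuous_on UNIV Y \<and> (\<forall>t\<ge>0. Y t = \<xi>' n t + frac_integral \<beta> (\<lambda>s. - l * Y s) t)" for n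
  proof -
    have "continuous_on UNIV (\<xi>' n)"
      unfolding \<xi>'_def by (intro continuous_on_compose2[OF \<xi>] continuous_intros) auto
    moreover have "bounded (range (\<xi>' n))"
    proof (rule bounded_subset)
      show "bounded (\<xi> ` {0..real n})"
        by (intro compact_imp_bounded compact_continuous_image continuous_on_subset[OF \<xi>]) auto
    qed (auto simp: \<xi>'_def)
    ultimately obtain Y where "continuous_on UNIV Y"
      "\<forall>t\<ge>0. Y t = \<xi>' n t + - l / Gamma \<beta> * (LINT s|lborel. abel_kernel \<beta> (t - s) * (indicator {0..} s * Y s))"
      using ex_linear_solution_bounded[OF \<beta>(1)] by blast
    then show ?thesis
      unfolding frac_integral_cmult(2) by (intro exI[of _ Y]) (simp add: frac_integral_def)
  qed
  then obtain Yn where Yn: "\<And>n. continuous_on UNIV (Yn n)"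
      "\<And>n t. 0 \<le> t \<Longrightarrow> Yn n t = \<xi>' n t + frac_integral \<beta> (\<lambda>s. - l * Yn n s) t"
    by metis
  have \<xi>'_eq: "\<xi>' n t = \<xi> t" if "0 \<le> t" "t \<le> real n" for n t
    using that by (simp add: \<xi>'_def)
  \<comment> \<open>Any index that is at least \<open>t\<close> would give the same value, as shown
    next.\<close>
  define Y where "Y = (\<lambda>t. Yn (nat \<lceil>t\<rceil>) t)"
  have Y_eq: "Y t = Yn n t" if "0 \<le> t" "t \<le> real n" for n t
    unfolding Y_def
  proof (rule linear_unique[OF \<beta> l, where T = t and \<xi> = \<xi> and Y = "Yn (nat \<lceil>t\<rceil>)" and Y' = "Yn n"])
    fix u assume "0 \<le> u" "u \<le> t"
    then have "u \<le> real (nat \<lceil>t\<rceil>)" "u \<le> real n" using that by linarith+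
    then show "Yn (nat \<lceil>t\<rceil>) u = \<xi> u + frac_integral \<beta> (\<lambda>s. - l * Yn (nat \<lceil>t\<rceil>) s) u"
      "Yn n u = \<xi> u + frac_integral \<beta> (\<lambda>s. - l * Yn n s) u"
      using Yn(2)[of u] \<open>0 \<le> u\<close> \<xi>'_eq[of u] by auto
  qed (use that in \<open>auto intro: continuous_on_subset[OF Yn(1)]\<close>)
  have "continuous_on {0..} Y"
  proof -
    have "continuous (at t within {0..}) Y" if "0 \<le> t" for t
    proof -
      \<comment> \<open>The strict inequality makes \<open>Y\<close> agree with the single function
        \<open>Yn n\<close> near \<open>t\<close>.\<close>
      obtain n where n: "t < real n" using reals_Archimedean2 by blast
      have "continuous (at t within {0..}) (Yn n)"
        using Yn(1)[of n] by (simp add: continuous_on_eq_continuous_at continuous_at_imp_continuous_within)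
      moreover have "eventually (\<lambda>u. u < real n) (at t within {0..})"
        using n by (intro order_tendstoD(2)[OF tendsto_ident_at])
      then have "eventually (\<lambda>u. Yn n u = Y u) (at t within {0..})"
        unfolding eventually_at_filter by (auto simp: Y_eq[of _ n] elim!: eventually_mono)
      ultimately show ?thesis
        using Y_eq[of t n] n that by (auto simp: continuous_within elim!: Lim_transform_eventually)
    qed
    then show ?thesis by (simp add: continuous_on_eq_continuous_within)
  qed
  moreover have "Y t = \<xi> t + frac_integral \<beta> (\<lambda>s. - l * Y s) t" if "0 \<le> t" for t
  proof -
    define n where "n = nat \<lceil>t\<rceil>"
    have n: "t \<le> real n" unfolding n_def by linarith
    have "frac_integral \<beta> (\<lambda>s. - l * Y s) t = frac_integral \<beta> (\<lambda>s. - l * Yn n s) t"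
      using n by (intro frac_integral_cong) (simp add: Y_eq[of _ n])
    then show ?thesis using Yn(2)[OF that, of n] Y_eq[OF that n] \<xi>'_eq[OF that n] by simp
  qed
  ultimately have "continuous_solution \<beta> (\<lambda>x. - l * x) \<xi> Y"
    using \<beta> by (auto simp: continuous_solution_iff intro!: frac_integrable_continuous continuous_intros)
  then show ?thesis by blast
qed

subsection \<open>Asymptotic comparison\<close>

text \<open>Convolution commutes with translation. As \<open>a \<ge> 0\<close>, the delayed source
  starts no earlier than time \<open>0\<close>, so the cut at \<open>0\<close> does not
  interfere.\<close>

lemma frac_integral_shift:
  assumes "0 \<le> a"
  shows "frac_integral \<beta> f (t - a) = frac_integral \<beta> (\<lambda>s. indicator {a..} s * f (s - a)) t"
proof -
  have "(LINT s|lborel. abel_kernel \<beta> (t - a - s) * (indicator {0..} s * f s))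
    = (LINT s|lborel. abel_kernel \<beta> (t - s) * (indicator {0..} (s - a) * f (s - a)))"
    by (subst lborel_integral_real_affine[where c = 1 and t = "- a"]) (auto simp: algebra_simps)
  also have "\<dots> = (LINT s|lborel. abel_kernel \<beta> (t - s) * (indicator {0..} s * (indicator {a..} s * f (s - a))))"
    using assms by (intro Bochner_Integration.integral_cong) (auto simp: indicator_def)
  finally show ?thesis by (simp add: frac_integral_def)
qed

lemma frac_integral_neg: "t \<le> 0 \<Longrightarrow> frac_integral \<beta> f t = 0"
proof -
  assume "t \<le> 0"
  then have *: "(\<lambda>s. abel_kernel \<beta> (t - s) * (indicator {0..} s * f s)) = (\<lambda>s. 0)"
    by (auto simp: fun_eq_iff abel_kernel_def indicator_def)
  show ?thesis unfolding frac_integral_def * by simp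
qed

lemma tendsto_at_top_mono_bounded:
  fixes f :: "real \<Rightarrow> real"
  assumes mono: "\<And>x y. x \<le> y \<Longrightarrow> f x \<le> f y" and B: "\<And>x. f x \<le> B"
  shows "(f \<longlongrightarrow> (SUP x. f x)) at_top"
proof (rule order_tendstoI)
  have bdd: "bdd_above (range f)" using B by (auto simp: bdd_above_def)
  fix a
  show "eventually (\<lambda>x. a < f x) at_top" if a: "a < (SUP x. f x)"
  proof -
    obtain x where "a < f x" using a less_cSUP_iff[of UNIV f a] bdd by auto
    then show ?thesis
      using mono by (auto simp: eventually_at_top_linorder intro: less_le_trans)
  qed
  show "eventually (\<lambda>x. f x < a) at_top" if "(SUP x. f x) < a"
    using le_less_trans[OF cSUP_upper[OF UNIV_I bdd] that] by (intro always_eventually allI)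
qed

text \<open>\<open>Q\<close> is the response to a unit source switched off at \<open>T\<close>; a
  multiple of it absorbs whatever a bounded source did before \<open>T\<close>.\<close>

lemma ex_decaying_barrier:
  assumes \<beta>: "0 < \<beta>" "\<beta> < 1" and l: "0 < l" and T: "0 \<le> T"
  shows "\<exists>Q. continuous_on UNIV Q \<and> (Q \<longlongrightarrow> 0) at_top \<and>
    (\<forall>t\<ge>0. Q t = frac_integral \<beta> (\<lambda>s. indicator {..<T} s - l * Q s) t)"
proof -
  obtain Y where "continuous_solution \<beta> (\<lambda>x. - l * x) (\<lambda>t. 1) Y"
    using ex_linear_solution[OF \<beta>, of l "\<lambda>t. 1"] l by auto
  then have Y: "continuous_on {0..} Y" "\<And>t. 0 \<le> t \<Longrightarrow> Y t = 1 + frac_integral \<beta> (\<lambda>s. - l * Y s) t"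
    by (auto simp: continuous_solution_iff)
  have Y0: "Y 0 = 1" using Y(2)[of 0] by (simp add: frac_integral_neg)
  \<comment> \<open>For initial datum \<open>1\<close>, \<open>1 - Y\<close> is \<open>l\<close>
    times the fractional integral of \<open>Y\<close>; hence \<open>P\<close> responds to the
    constant source \<open>1\<close>. The extension by \<open>0\<close> gives
    \<open>P (t - a)\<close> a meaning before time \<open>a\<close>.\<close>
  define P where "P = (\<lambda>t. (1 - Y (max 0 t)) / l)"
  have contP: "continuous_on A P" for A
    unfolding P_def using l by (intro continuous_intros continuous_on_compose2[OF Y(1)]) auto
  have P0: "P t = 0" if "t \<le> 0" for t using that Y0 by (simp add: P_def max_def)
  have P: "P t = frac_integral \<beta> (\<lambda>s. 1 - l * P s) t" for t
  proof (cases "0 \<le> t")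
    case True
    have "frac_integral \<beta> (\<lambda>s. 1 - l * P s) t = frac_integral \<beta> Y t"
      using l by (intro frac_integral_cong) (simp add: P_def)
    moreover have "Y t = 1 - l * frac_integral \<beta> Y t"
      using Y(2)[OF True] frac_integral_cmult(2)[of \<beta> "- l" Y t] by simp
    ultimately show ?thesis using True l by (simp add: P_def)
  qed (simp add: P0 frac_integral_neg)
  \<comment> \<open>All delays \<open>a \<ge> 0\<close> are treated at once: nonnegativity of
    \<open>Q a\<close> for every \<open>a\<close> is the monotonicity of \<open>P\<close>, from
    which the case \<open>a = T\<close> gets its decay.\<close>
  define Q where "Q = (\<lambda>a t. P t - P (t - a))"
  have contQ: "continuous_on A (Q a)" for a A
    unfolding Q_def by (intro continuous_intros contP continuous_on_compose2[OF contP[of UNIV]]) auto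
  have Q: "Q a t = frac_integral \<beta> (\<lambda>s. indicator {..<a} s - l * Q a s) t" if a: "0 \<le> a" for a t
  proof -
    have m: "set_borel_measurable borel {0..} (\<lambda>s. indicator {a..} s * (1 - l * P (s - a)))"
    proof -
      have [measurable]: "P \<in> borel_measurable borel"
        using contP[of UNIV] by (rule borel_measurable_continuous_onI)
      show ?thesis unfolding set_borel_measurable_def by measurable
    qed
    obtain K where K: "\<And>s. - a \<le> s \<Longrightarrow> s \<le> t \<Longrightarrow> \<bar>1 - l * P s\<bar> \<le> K"
    proof (rule continuous_on_Icc_bounded)
      show "continuous_on {- a..t} (\<lambda>s. 1 - l * P s)" by (intro continuous_intros contP)
    qed blast
    have "frac_integrable \<beta> (\<lambda>s. indicator {a..} s * (1 - l * P (s - a))) t"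
    proof (rule frac_integrable_bounded[OF \<beta>(1) m, of t "K"])
      fix s assume "0 \<le> s" "s \<le> t"
      then have "\<bar>1 - l * P (s - a)\<bar> \<le> K" using K[of "s - a"] a by simp
      then show "\<bar>indicator {a..} s * (1 - l * P (s - a))\<bar> \<le> K"
        by (auto simp: indicator_def intro: order_trans[OF abs_ge_zero])
    qed
    moreover have "frac_integrable \<beta> (\<lambda>s. 1 - l * P s) t"
      by (intro frac_integrable_continuous \<beta> continuous_intros contP)
    ultimately have "frac_integral \<beta> (\<lambda>s. (1 - l * P s) - indicator {a..} s * (1 - l * P (s - a))) t
      = frac_integral \<beta> (\<lambda>s. 1 - l * P s) t - frac_integral \<beta> (\<lambda>s. 1 - l * P s) (t - a)"
      unfolding frac_integral_shift[OF a] by (rule frac_integral_diff(2)[rotated])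
    moreover have "frac_integral \<beta> (\<lambda>s. (1 - l * P s) - indicator {a..} s * (1 - l * P (s - a))) t
      = frac_integral \<beta> (\<lambda>s. indicator {..<a} s - l * Q a s) t"
      by (intro frac_integral_cong) (auto simp: indicator_def Q_def P0 algebra_simps)
    ultimately show ?thesis unfolding Q_def P[symmetric] by simp
  qed
  have Q_nonneg: "0 \<le> Q a t" if "0 \<le> a" for a t
  proof (cases "0 \<le> t")
    case True
    have "- Q a t \<le> 0"
    proof (rule comparison[OF \<beta> less_imp_le[OF l], where T = t and g = "\<lambda>s. - indicator {..<a} s" and B = 1 and Z = "\<lambda>t. - Q a t"])
      show "- Q a t = frac_integral \<beta> (\<lambda>s. - indicator {..<a} s - l * - Q a s) t" for t
        using Q[OF that, of t] frac_integral_cmult(2)[of \<beta> "-1" "\<lambda>s. indicator {..<a} s - l * Q a s" t] by (simp add: algebra_simps)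
    qed (use True contQ in \<open>auto simp: set_borel_measurable_def indicator_def intro!: continuous_intros\<close>)
    then show ?thesis by simp
  qed (use that in \<open>simp add: Q_def P0\<close>)
  have P_mono: "P x \<le> P y" if "x \<le> y" for x y
    using Q_nonneg[of "y - x" y] that by (simp add: Q_def)
  have P_le: "P t \<le> 1 / l" for t
  proof (cases "0 \<le> t")
    case True
    show ?thesis
      by (rule comparison[OF \<beta> less_imp_le[OF l] _ _ contP P, where T = t and B = 1])
        (use True l in \<open>auto simp: set_borel_measurable_def\<close>)
  qed (use l in \<open>simp add: P0\<close>)
  have lim: "(P \<longlongrightarrow> (SUP x. P x)) at_top"
    by (rule tendsto_at_top_mono_bounded[OF P_mono P_le])
  have "filterlim (\<lambda>t. t - T) at_top at_top"
    using filterlim_tendsto_add_at_top[OF tendsto_const filterlim_ident, of "- T"] by simp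
  from tendsto_diff[OF lim filterlim_compose[OF lim this]]
  have "(Q T \<longlongrightarrow> 0) at_top" by (simp add: Q_def)
  then show ?thesis
    by (intro exI[of _ "Q T"] conjI allI impI contQ Q[OF T])
qed

text \<open>\<open>Z - B * Q\<close> has source \<open>g - B * indicator {..<T}\<close>, which is
  nonpositive before \<open>T\<close> and at most \<open>l * m\<close> afterwards. Comparison gives
  \<open>Z \<le> m + B * Q\<close>, and \<open>Q\<close> tends to \<open>0\<close>.\<close>

lemma eventually_comparison_upper:
  assumes \<beta>: "0 < \<beta>" "\<beta> < 1" and l: "0 < l"
    and g: "set_borel_measurable borel {0..} g" and gB: "\<And>s. 0 \<le> s \<Longrightarrow> \<bar>g s\<bar> \<le> B"
    and cont: "continuous_on {0..} Z"
    and Z: "\<And>t. 0 \<le> t \<Longrightarrow> Z t = frac_integral \<beta> (\<lambda>s. g s - l * Z s) t"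
    and m: "0 \<le> m" and gm: "eventually (\<lambda>s. g s \<le> l * m) at_top" and e: "0 < e"
  shows "eventually (\<lambda>t. Z t \<le> m + e) at_top"
proof -
  obtain T where T: "0 \<le> T" "\<And>s. T \<le> s \<Longrightarrow> g s \<le> l * m"
  proof -
    obtain T where "\<And>s. T \<le> s \<Longrightarrow> g s \<le> l * m" using gm by (auto simp: eventually_at_top_linorder)
    then show ?thesis by (intro that[of "max 0 T"]) auto
  qed
  obtain Q where contQ: "continuous_on UNIV Q" and Q0: "(Q \<longlongrightarrow> 0) at_top"
    and Q: "\<And>t. 0 \<le> t \<Longrightarrow> Q t = frac_integral \<beta> (\<lambda>s. indicator {..<T} s - l * Q s) t"
    using ex_decaying_barrier[OF \<beta> l T(1)] by auto
  note contQ' = continuous_on_subset[OF contQ subset_UNIV]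
  have B: "0 \<le> B" using gB[of 0] by simp
  have le: "Z t - B * Q t \<le> m" if "0 \<le> t" for t
  proof (rule comparison[OF \<beta> less_imp_le[OF l], where T = t and g = "\<lambda>s. g s - B * indicator {..<T} s" and B = "2 * B" and Z = "\<lambda>t. Z t - B * Q t"])
    show "set_borel_measurable borel {0..} (\<lambda>s. g s - B * indicator {..<T} s)"
    proof -
      have [measurable]: "(\<lambda>s. indicator {0..} s * g s) \<in> borel_measurable borel"
        using g by (simp add: set_borel_measurable_def)
      have "(\<lambda>s. indicator {0..} s * g s - indicator {0..} s * (B * indicator {..<T} s)) \<in> borel_measurable borel"
        by measurable
      then show ?thesis by (simp add: set_borel_measurable_def right_diff_distrib)
    qed
    show "\<bar>g s - B * indicator {..<T} s\<bar> \<le> 2 * B" if "0 \<le> s" for s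
      using gB[OF that] B by (auto simp: indicator_def)
    show "continuous_on {0..t} (\<lambda>t. Z t - B * Q t)"
      by (intro continuous_intros contQ' continuous_on_subset[OF cont]) auto
    show "g s - B * indicator {..<T} s \<le> l * m" if "0 \<le> s" for s
    proof (cases "s < T")
      case True
      have "0 \<le> l * m" using l m by simp
      then show ?thesis using True gB[OF that] by simp
    qed (use T(2)[of s] in simp)
    show "Z t - B * Q t = frac_integral \<beta> (\<lambda>s. g s - B * indicator {..<T} s - l * (Z s - B * Q s)) t" if "0 \<le> t" for t
    proof -
      obtain K where K: "\<And>s. 0 \<le> s \<Longrightarrow> s \<le> t \<Longrightarrow> \<bar>Z s\<bar> \<le> K"
        using continuous_on_Icc_bounded[OF continuous_on_subset[OF cont], of 0 t] by auto
      have "frac_integrable \<beta> g t" 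
        using gB by (intro frac_integrable_bounded[OF \<beta>(1) g]) auto
      then have 1: "frac_integrable \<beta> (\<lambda>s. g s - l * Z s) t"
        by (rule frac_integral_diff(1)[OF _ frac_integral_cmult(1)[OF frac_integrable_continuous[OF \<beta>(1) cont]]])
      have "frac_integrable \<beta> (indicator {..<T}) t"
        by (rule frac_integrable_bounded[OF \<beta>(1), of _ _ 1]) (auto simp: set_borel_measurable_def indicator_def)
      then have 2: "frac_integrable \<beta> (\<lambda>s. indicator {..<T} s - l * Q s) t"
        by (rule frac_integral_diff(1)[OF _ frac_integral_cmult(1)[OF frac_integrable_continuous[OF \<beta>(1) contQ']]])
      have "frac_integral \<beta> (\<lambda>s. (g s - l * Z s) - B * (indicator {..<T} s - l * Q s)) t
        = frac_integral \<beta> (\<lambda>s. g s - l * Z s) t - B * frac_integral \<beta> (\<lambda>s. indicator {..<T} s - l * Q s) t"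
        using frac_integral_diff(2)[OF 1 frac_integral_cmult(1)[OF 2]] by (simp add: frac_integral_cmult(2))
      then show ?thesis using Z[OF that] Q[OF that] by (simp add: algebra_simps)
    qed
  qed (use that m in auto)
  have "((\<lambda>t. B * Q t) \<longlongrightarrow> B * 0) at_top" by (intro tendsto_intros Q0)
  then have "eventually (\<lambda>t. B * Q t < e) at_top" using e by (auto dest: order_tendstoD(2))
  then show ?thesis
    using eventually_ge_at_top[of 0]
  proof eventually_elim
    case (elim t)
    then show ?case using le[of t] by linarith
  qed
qed

lemma eventually_comparison:
  assumes \<beta>: "0 < \<beta>" "\<beta> < 1" and l: "0 < l"
    and g: "set_borel_measurable borel {0..} g" and gB: "\<And>s. 0 \<le> s \<Longrightarrow> \<bar>g s\<bar> \<le> B"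
    and cont: "continuous_on {0..} Z"
    and Z: "\<And>t. 0 \<le> t \<Longrightarrow> Z t = frac_integral \<beta> (\<lambda>s. g s - l * Z s) t"
    and m: "0 \<le> m" and gm: "eventually (\<lambda>s. \<bar>g s\<bar> \<le> l * m) at_top" and e: "0 < e"
  shows "eventually (\<lambda>t. \<bar>Z t\<bar> \<le> m + e) at_top"
proof -
  have "eventually (\<lambda>t. Z t \<le> m + e) at_top"
    using gm by (intro eventually_comparison_upper[OF \<beta> l g gB cont Z m _ e]) (auto elim!: eventually_mono)
  moreover have "eventually (\<lambda>t. - Z t \<le> m + e) at_top"
  proof (rule eventually_comparison_upper[OF \<beta> l, where g = "\<lambda>s. - g s" and B = B])
    show "set_borel_measurable borel {0..} (\<lambda>s. - g s)"
      using g by (simp add: set_borel_measurable_def)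
    show "- Z t = frac_integral \<beta> (\<lambda>s. - g s - l * - Z s) t" if "0 \<le> t" for t
      using Z[OF that] frac_integral_cmult(2)[of \<beta> "-1" "\<lambda>s. g s - l * Z s" t] by (simp add: algebra_simps)
    show "eventually (\<lambda>s. - g s \<le> l * m) at_top"
      using gm by (auto elim!: eventually_mono)
  qed (use cont m gB e in \<open>auto intro!: continuous_intros\<close>)
  ultimately show ?thesis by eventually_elim linarith
qed

subsection \<open>Stability of the perturbed equation\<close>

lemma difference_equation:
  assumes \<beta>: "0 < \<beta>"
    and X: "continuous_solution \<beta> (\<lambda>x. - l * x + h x) \<xi> X"
    and Y: "continuous_solution \<beta> (\<lambda>x. - l * x) \<xi> Y" and t: "0 \<le> t"
  shows "X t - Y t = frac_integral \<beta> (\<lambda>s. h (X s) - l * (X s - Y s)) t"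
proof -
  have "frac_integral \<beta> (\<lambda>s. (- l * X s + h (X s)) - (- l * Y s)) t
    = frac_integral \<beta> (\<lambda>s. - l * X s + h (X s)) t - frac_integral \<beta> (\<lambda>s. - l * Y s) t"
    using X Y t by (intro frac_integral_diff) (auto simp: continuous_solution_iff)
  also have "\<dots> = X t - Y t"
    using X Y t by (simp add: continuous_solution_iff)
  finally show ?thesis by (simp add: algebra_simps)
qed

lemma set_borel_measurable_compose:
  fixes h X :: "real \<Rightarrow> real"
  assumes "h \<in> borel_measurable borel" "continuous_on {0..} X"
  shows "set_borel_measurable borel {0..} (\<lambda>s. h (X s))"
proof -
  \<comment> \<open>\<open>max 0 s\<close> extends \<open>X\<close> continuously to the whole line
    without changing it on \<open>{0..}\<close>.\<close>
  have "continuous_on UNIV (\<lambda>s. X (max 0 s))"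
    by (intro continuous_on_compose2[OF assms(2)] continuous_intros) auto
  then have [measurable]: "(\<lambda>s. X (max 0 s)) \<in> borel_measurable borel"
    by (rule borel_measurable_continuous_onI)
  note assms(1)[measurable]
  have "(\<lambda>s. indicator {0..} s *\<^sub>R h (X (max 0 s))) \<in> borel_measurable borel" by measurable
  also have "(\<lambda>s. indicator {0..} s *\<^sub>R h (X (max 0 s))) = (\<lambda>s. indicator {0..} s *\<^sub>R h (X s))"
    by (auto simp: fun_eq_iff indicator_def)
  finally show ?thesis by (simp add: set_borel_measurable_def)
qed

text \<open>At a maximum point \<open>u\<close> of \<open>\<bar>X\<bar>\<close>, comparison gives
  \<open>\<bar>X u - Y u\<bar> \<le> C / l * \<bar>X u\<bar>\<close>. Since
  \<open>C / l < 1\<close>, the right side can be absorbed.\<close>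

lemma perturbed_bound:
  assumes \<beta>: "0 < \<beta>" "\<beta> < 1" and C: "0 < C" "C < l" and h: "h \<in> borel_measurable borel"
    and X: "continuous_solution \<beta> (\<lambda>x. - l * x + h x) \<xi> X"
    and Y: "continuous_solution \<beta> (\<lambda>x. - l * x) \<xi> Y"
    and hX: "\<And>s. 0 \<le> s \<Longrightarrow> s \<le> T \<Longrightarrow> \<bar>h (X s)\<bar> \<le> C * \<bar>X s\<bar>"
    and S: "\<And>s. 0 \<le> s \<Longrightarrow> s \<le> T \<Longrightarrow> \<bar>Y s\<bar> \<le> S"
    and t: "0 \<le> t" "t \<le> T"
  shows "\<bar>X t\<bar> \<le> S / (1 - C / l)"
proof -
  have cont: "continuous_on {0..} X" "continuous_on {0..} Y"
    using X Y by (auto simp: continuous_solution_iff)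
  have "continuous_on {0..T} (\<lambda>t. \<bar>X t\<bar>)"
    by (intro continuous_intros continuous_on_subset[OF cont(1)]) auto
  then obtain u where u: "0 \<le> u" "u \<le> T" and max: "\<And>s. 0 \<le> s \<Longrightarrow> s \<le> T \<Longrightarrow> \<bar>X s\<bar> \<le> \<bar>X u\<bar>"
    using continuous_attains_sup[of "{0..T}" "\<lambda>t. \<bar>X t\<bar>"] t by auto
  have "\<bar>X u - Y u\<bar> \<le> C / l * \<bar>X u\<bar>"
  proof (rule comparison_abs[OF \<beta>, where T = T and g = "\<lambda>s. h (X s)" and l = l and Z = "\<lambda>t. X t - Y t"])
    show "continuous_on {0..T} (\<lambda>t. X t - Y t)"
      by (intro continuous_intros continuous_on_subset[OF cont(1)] continuous_on_subset[OF cont(2)]) auto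
    show "\<bar>h (X s)\<bar> \<le> l * (C / l * \<bar>X u\<bar>)" if "0 \<le> s" "s \<le> T" for s
    proof -
      have "C * \<bar>X s\<bar> \<le> C * \<bar>X u\<bar>" using max[OF that] C by (intro mult_left_mono) auto
      also have "\<dots> = l * (C / l * \<bar>X u\<bar>)" using C by simp
      finally show ?thesis using hX[OF that] by linarith
    qed
  qed (use C u h cont difference_equation[OF \<beta>(1) X Y] in \<open>auto intro: set_borel_measurable_compose\<close>)
  then have "(1 - C / l) * \<bar>X u\<bar> \<le> S"
    using S[OF u] by (simp add: left_diff_distrib)
  then have "\<bar>X u\<bar> \<le> S / (1 - C / l)"
    using C by (simp add: pos_le_divide_eq mult.commute)
  then show ?thesis using max[OF t] by simp
qed

text \<open>The limit superior \<open>q\<close> of \<open>\<bar>X\<bar>\<close> is finite by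
  \<open>perturbed_bound\<close> and satisfies \<open>q \<le> r * q\<close> with
  \<open>r < 1\<close>, hence is \<open>0\<close>.\<close>

lemma perturbed_tendsto_0:
  assumes \<beta>: "0 < \<beta>" "\<beta> < 1" and C: "0 < C" "C < l" and h: "h \<in> borel_measurable borel"
    and X: "continuous_solution \<beta> (\<lambda>x. - l * x + h x) \<xi> X"
    and Y: "continuous_solution \<beta> (\<lambda>x. - l * x) \<xi> Y"
    and hX: "\<And>s. 0 \<le> s \<Longrightarrow> \<bar>h (X s)\<bar> \<le> C * \<bar>X s\<bar>"
    and Y0: "(Y \<longlongrightarrow> 0) at_top"
  shows "(X \<longlongrightarrow> 0) at_top"
proof -
  have cont: "continuous_on {0..} X" "continuous_on {0..} Y"
    using X Y by (auto simp: continuous_solution_iff)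
  have l: "0 < l" using C by simp
  define r where "r = C / l"
  have r: "0 < r" "r < 1" using C by (auto simp: r_def)
  obtain S where S: "\<And>s. 0 \<le> s \<Longrightarrow> \<bar>Y s\<bar> \<le> S"
  proof -
    have "eventually (\<lambda>t. \<bar>Y t\<bar> < 1) at_top"
      using tendstoD[OF Y0, of 1] by (simp add: dist_real_def)
    then obtain T where T: "\<And>t. T \<le> t \<Longrightarrow> \<bar>Y t\<bar> < 1" by (auto simp: eventually_at_top_linorder)
    obtain K where K: "\<And>s. 0 \<le> s \<Longrightarrow> s \<le> T \<Longrightarrow> \<bar>Y s\<bar> \<le> K"
      using continuous_on_Icc_bounded[OF continuous_on_subset[OF cont(2)], of 0 T] by auto
    have "\<bar>Y s\<bar> \<le> max 1 K" if "0 \<le> s" for s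
      using T[of s] K[of s] that by (cases "s \<le> T") auto
    then show ?thesis using that by blast
  qed
  define M where "M = S / (1 - r)"
  have M: "\<bar>X t\<bar> \<le> M" if "0 \<le> t" for t
    unfolding M_def r_def
    by (rule perturbed_bound[OF \<beta> C h X Y hX S, where T = t]) (use that in auto)
  have M0: "0 \<le> M" using M[of 0] by simp
  \<comment> \<open>Once \<open>\<bar>X\<bar> \<le> q\<close>, the source satisfies
    \<open>\<bar>h (X s)\<bar> \<le> C * q = l * (r * q)\<close>. Half of \<open>e\<close> is spent
    on \<open>X - Y\<close>, half on \<open>Y\<close>.\<close>
  have step: "eventually (\<lambda>t. \<bar>X t\<bar> \<le> r * q + e) at_top"
    if q: "0 \<le> q" "eventually (\<lambda>t. \<bar>X t\<bar> \<le> q) at_top" and e: "0 < e" for q e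
  proof -
    have "eventually (\<lambda>t. \<bar>X t - Y t\<bar> \<le> r * q + e / 2) at_top"
    proof (rule eventually_comparison[OF \<beta> l, where g = "\<lambda>s. h (X s)" and B = "C * M"])
      show "\<bar>h (X s)\<bar> \<le> C * M" if "0 \<le> s" for s
        using hX[OF that] mult_left_mono[OF M[OF that] less_imp_le[OF C(1)]] by linarith
      show "eventually (\<lambda>s. \<bar>h (X s)\<bar> \<le> l * (r * q)) at_top"
        using q(2) eventually_ge_at_top[of 0]
      proof eventually_elim
        case (elim s)
        then have "C * \<bar>X s\<bar> \<le> C * q" using C by (intro mult_left_mono) auto
        also have "\<dots> = l * (r * q)" using C by (simp add: r_def)
        finally show ?case using hX[OF elim(2)] by linarith
      qed
      show "continuous_on {0..} (\<lambda>t. X t - Y t)" by (intro continuous_intros cont)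
    qed (use r q e h cont difference_equation[OF \<beta>(1) X Y] in \<open>auto intro: set_borel_measurable_compose\<close>)
    moreover have "eventually (\<lambda>t. \<bar>Y t\<bar> < e / 2) at_top"
      using tendstoD[OF Y0, of "e / 2"] e by (simp add: dist_real_def)
    ultimately show ?thesis by eventually_elim linarith
  qed
  \<comment> \<open>The infimum of all eventual bounds is the limit superior. It need not be
    attained, hence the slack in \<open>near\<close>.\<close>
  define q where "q = Inf {q. 0 \<le> q \<and> eventually (\<lambda>t. \<bar>X t\<bar> \<le> q) at_top}" (is "_ = Inf ?A")
  have "eventually (\<lambda>t. \<bar>X t\<bar> \<le> M) at_top"
    using M by (auto simp: eventually_at_top_linorder)
  then have A: "?A \<noteq> {}" using M0 by auto
  have bdd: "bdd_below ?A" by (auto simp: bdd_below_def)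
  have q0: "0 \<le> q" unfolding q_def using A by (intro cInf_greatest) auto
  have near: "eventually (\<lambda>t. \<bar>X t\<bar> \<le> q + e) at_top" if "0 < e" for e
  proof -
    have "Inf ?A < q + e" using that by (simp add: q_def)
    then obtain p where "p \<in> ?A" "p < q + e" using cInf_less_iff[OF A bdd] by auto
    then show ?thesis by (auto elim!: eventually_mono)
  qed
  have "q \<le> r * q"
  proof (rule field_le_epsilon)
    fix e :: real assume e: "0 < e"
    have "eventually (\<lambda>t. \<bar>X t\<bar> \<le> r * (q + e / 2) + e / 2) at_top"
      using e q0 by (intro step near) auto
    moreover have "0 \<le> r * (q + e / 2) + e / 2" using e q0 r by simp
    ultimately have "q \<le> r * (q + e / 2) + e / 2"
      unfolding q_def using bdd by (intro cInf_lower) auto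
    also have "\<dots> \<le> r * q + e"
      using e r mult_right_mono[of r 1 "e / 2"] unfolding distrib_left by linarith
    finally show "q \<le> r * q + e" .
  qed
  then have "(1 - r) * q \<le> 0" by (simp add: left_diff_distrib)
  then have "q = 0" using r q0 by (simp add: mult_le_0_iff)
  show ?thesis
  proof (rule tendstoI)
    fix e :: real assume "0 < e"
    then have "eventually (\<lambda>t. \<bar>X t\<bar> \<le> e / 2) at_top" using near[of "e / 2"] \<open>q = 0\<close> by simp
    then show "eventually (\<lambda>t. dist (X t) 0 < e) at_top"
      using \<open>0 < e\<close> by (auto simp: dist_real_def elim!: eventually_mono)
  qed
qed

text \<open>First-exit argument: until \<open>\<bar>X\<bar>\<close> first reaches a level
  \<open>b\<close> between \<open>a\<close> and \<open>d\<close>, the local bound on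
  \<open>h\<close> holds, and \<open>perturbed_bound\<close> keeps \<open>\<bar>X\<bar>\<close> at
  most \<open>a < b\<close>. The factor \<open>1 - C / l\<close> in \<open>S\<close> compensates the
  loss there.\<close>

lemma small_perturbed_bound:
  assumes \<beta>: "0 < \<beta>" "\<beta> < 1" and C: "0 < C" "C < l" and h: "h \<in> borel_measurable borel"
    and hC: "\<And>x. \<bar>x\<bar> < d \<Longrightarrow> \<bar>h x\<bar> \<le> C * \<bar>x\<bar>"
    and X: "continuous_solution \<beta> (\<lambda>x. - l * x + h x) \<xi> X"
    and Y: "continuous_solution \<beta> (\<lambda>x. - l * x) \<xi> Y"
    and a: "0 < a" "a < d" and S: "\<And>s. 0 \<le> s \<Longrightarrow> \<bar>Y s\<bar> \<le> (1 - C / l) * a"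
    and t: "0 \<le> t"
  shows "\<bar>X t\<bar> \<le> a"
proof (rule ccontr)
  assume "\<not> \<bar>X t\<bar> \<le> a"
  \<comment> \<open>The midpoint keeps \<open>b < d\<close>; the minimum with
    \<open>\<bar>X t\<bar>\<close> ensures that the level is reached by time
    \<open>t\<close>.\<close>
  define b where "b = min \<bar>X t\<bar> ((a + d) / 2)"
  have b: "a < b" "b < d" "b \<le> \<bar>X t\<bar>" using \<open>\<not> \<bar>X t\<bar> \<le> a\<close> a by (auto simp: b_def min_less_iff_disj)
  have r: "0 < 1 - C / l" "1 - C / l < 1" using C by auto
  have cont: "continuous_on {0..} X"
    using X by (auto simp: continuous_solution_iff)
  \<comment> \<open>At time \<open>0\<close> the integrals vanish, so both solutions equal
    \<open>\<xi> 0\<close> and \<open>X\<close> starts below the level.\<close>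
  have "X 0 = Y 0" using X Y by (simp add: continuous_solution_iff frac_integral_neg)
  then have X0: "\<bar>X 0\<bar> \<le> b" using S[of 0] b a r mult_right_mono[of "1 - C / l" 1 a] by linarith
  define T where "T = Inf {s \<in> {0..t}. b \<le> \<bar>X s\<bar>}" (is "_ = Inf ?A")
  have "t \<in> ?A" using t b by auto
  have bdd: "bdd_below ?A" by (auto simp: bdd_below_def)
  have "continuous_on {0..t} (\<lambda>s. \<bar>X s\<bar>)"
    by (intro continuous_intros continuous_on_subset[OF cont]) auto
  then have "closed ({0..t} \<inter> (\<lambda>s. \<bar>X s\<bar>) -` {b..})"
    by (intro continuous_closed_preimage) auto
  also have "{0..t} \<inter> (\<lambda>s. \<bar>X s\<bar>) -` {b..} = ?A" by auto
  finally have T: "T \<in> ?A"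
    unfolding T_def using \<open>t \<in> ?A\<close> bdd by (intro closed_contains_Inf) auto
  have before: "\<bar>X s\<bar> < b" if "0 \<le> s" "s < T" for s
  proof (rule ccontr)
    assume "\<not> \<bar>X s\<bar> < b"
    then have "s \<in> ?A" using that T by auto
    then show False using cInf_lower[OF _ bdd, of s] that by (simp add: T_def)
  qed
  \<comment> \<open>Membership in the set gives only \<open>b \<le> \<bar>X T\<bar>\<close>;
    equality is needed to have \<open>\<bar>X T\<bar> < d\<close>, so that the bound on
    \<open>h\<close> holds at \<open>T\<close> too.\<close>
  have "\<bar>X T\<bar> = b"
  proof -
    have "continuous_on {0..T} (\<lambda>s. \<bar>X s\<bar>)"
      by (intro continuous_intros continuous_on_subset[OF cont]) auto
    then obtain s where "0 \<le> s" "s \<le> T" "\<bar>X s\<bar> = b"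
      using IVT'[of "\<lambda>s. \<bar>X s\<bar>" 0 b T] X0 T by auto
    then show ?thesis using before[of s] by (cases "s = T") auto
  qed
  moreover have "\<bar>X T\<bar> \<le> (1 - C / l) * a / (1 - C / l)"
  proof (rule perturbed_bound[OF \<beta> C h X Y, where T = T])
    show "\<bar>h (X s)\<bar> \<le> C * \<bar>X s\<bar>" if "0 \<le> s" "s \<le> T" for s
      using before[of s] that \<open>\<bar>X T\<bar> = b\<close> b by (cases "s = T") (auto intro!: hC)
  qed (use S T in auto)
  ultimately show False using b r(1) by (simp only: nonzero_mult_div_cancel_left[OF less_imp_neq[OF r(1), symmetric]])
qed

lemma SUP_abs_lessD:
  fixes Y :: "real \<Rightarrow> real"
  assumes "(SUP t\<in>{0..}. ereal \<bar>Y t\<bar>) < ereal e" "0 \<le> t"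
  shows "\<bar>Y t\<bar> < e"
proof -
  have "ereal \<bar>Y t\<bar> \<le> (SUP t\<in>{0..}. ereal \<bar>Y t\<bar>)" using assms(2) by (intro SUP_upper) auto
  then have "ereal \<bar>Y t\<bar> < ereal e" using assms(1) by (rule le_less_trans)
  then show ?thesis by simp
qed

text \<open>Each \<open>X\<close> is paired with an existing \<open>Y\<close> for the same datum.
  Smallness of \<open>Y\<close> confines \<open>X\<close> to the region where the bound on
  \<open>h\<close> holds; there the decay of \<open>Y\<close> forces that of
  \<open>X\<close>.\<close>

lemma asymptotically_stable_perturbed:
  assumes \<beta>: "0 < \<beta>" "\<beta> < 1" and C: "0 < C" "C < l" and h: "h \<in> borel_measurable borel"
    and d: "0 < d" and hC: "\<And>x. \<bar>x\<bar> < d \<Longrightarrow> \<bar>h x\<bar> \<le> C * \<bar>x\<bar>"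
    and E: "\<And>\<xi>. \<xi> \<in> E \<Longrightarrow> continuous_on {0..} \<xi>"
    and stab: "asymptotically_stable E nrm (continuous_solution \<beta> (\<lambda>x. - l * x))"
  shows "asymptotically_stable E nrm (continuous_solution \<beta> (\<lambda>x. - l * x + h x))"
proof -
  let ?Y = "continuous_solution \<beta> (\<lambda>x. - l * x)" and ?X = "continuous_solution \<beta> (\<lambda>x. - l * x + h x)"
  have ex: "\<exists>Y. ?Y \<xi> Y" if "\<xi> \<in> E" for \<xi>
    using ex_linear_solution[OF \<beta> _ E[OF that]] C by simp
  have small: "\<exists>\<delta>>0. \<forall>\<xi>\<in>E. nrm \<xi> < \<delta> \<longrightarrow> (\<forall>X. ?X \<xi> X \<longrightarrow> (\<forall>t\<ge>0. \<bar>X t\<bar> \<le> a))"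
    if a: "0 < a" "a < d" for a
  proof -
    have "0 < (1 - C / l) * a" using a C by simp
    with stab[unfolded asymptotically_stable_def stable_def, THEN conjunct1, rule_format]
    obtain \<delta> where "0 < \<delta>"
      and \<delta>: "\<forall>\<xi>\<in>E. nrm \<xi> < \<delta> \<longrightarrow> (\<forall>Y. ?Y \<xi> Y \<longrightarrow> (SUP t\<in>{0..}. ereal \<bar>Y t\<bar>) < ereal ((1 - C / l) * a))"
      by blast
    show ?thesis
    proof (intro exI conjI ballI impI allI)
      fix \<xi> X t assume *: "\<xi> \<in> E" "nrm \<xi> < \<delta>" "?X \<xi> X" "0 \<le> (t::real)"
      obtain Y where Y: "?Y \<xi> Y" using ex *(1) by blast
      have Yb: "\<bar>Y s\<bar> \<le> (1 - C / l) * a" if "0 \<le> s" for s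
        using SUP_abs_lessD[OF \<delta>[rule_format, OF *(1,2) Y] that] by (rule less_imp_le)
      show "\<bar>X t\<bar> \<le> a"
        by (rule small_perturbed_bound[OF \<beta> C h hC *(3) Y a Yb *(4)])
    qed fact
  qed
  have "stable E nrm ?X"
    unfolding stable_def
  proof (intro allI impI)
    fix e :: real assume e: "0 < e"
    \<comment> \<open>Staying below \<open>d\<close> permits \<open>small\<close>. The margin below
      \<open>e\<close> is needed because the pointwise bound \<open>a\<close> gives only a weak
      inequality for the supremum.\<close>
    define a where "a = min e d / 2"
    have a: "0 < a" "a < d" "a < e" using e d by (auto simp: a_def)
    obtain \<delta> where "0 < \<delta>"
      and \<delta>: "\<And>\<xi> X t. \<xi> \<in> E \<Longrightarrow> nrm \<xi> < \<delta> \<Longrightarrow> ?X \<xi> X \<Longrightarrow> 0 \<le> t \<Longrightarrow> \<bar>X t\<bar> \<le> a"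
      using small[OF a(1,2)] by blast
    have "(SUP t\<in>{0..}. ereal \<bar>X t\<bar>) < ereal e" if "\<xi> \<in> E" "nrm \<xi> < \<delta>" "?X \<xi> X" for \<xi> X
    proof -
      have "(SUP t\<in>{0..}. ereal \<bar>X t\<bar>) \<le> ereal a"
        using \<delta>[OF that] by (intro SUP_least) auto
      also have "\<dots> < ereal e" using a by simp
      finally show ?thesis .
    qed
    then show "\<exists>\<delta>>0. \<forall>\<xi>\<in>E. nrm \<xi> < \<delta> \<longrightarrow> (\<forall>X. ?X \<xi> X \<longrightarrow> (SUP t\<in>{0..}. ereal \<bar>X t\<bar>) < ereal e)"
      using \<open>0 < \<delta>\<close> by blast
  qed
  moreover have "\<exists>\<delta>>0. \<forall>\<xi>\<in>E. nrm \<xi> < \<delta> \<longrightarrow> (\<forall>X. ?X \<xi> X \<longrightarrow> (X \<longlongrightarrow> 0) at_top)"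
  proof -
    \<comment> \<open>The level \<open>d / 2\<close> keeps \<open>X\<close> where the bound on
      \<open>h\<close> holds at all times, as \<open>perturbed_tendsto_0\<close> demands.\<close>
    obtain \<delta>\<^sub>1 where "0 < \<delta>\<^sub>1"
      and \<delta>1: "\<And>\<xi> X t. \<xi> \<in> E \<Longrightarrow> nrm \<xi> < \<delta>\<^sub>1 \<Longrightarrow> ?X \<xi> X \<Longrightarrow> 0 \<le> t \<Longrightarrow> \<bar>X t\<bar> \<le> d / 2"
      using small[of "d / 2"] d by auto
    from stab[unfolded asymptotically_stable_def, THEN conjunct2]
    obtain \<delta>\<^sub>2 where "0 < \<delta>\<^sub>2"
      and \<delta>2: "\<forall>\<xi>\<in>E. nrm \<xi> < \<delta>\<^sub>2 \<longrightarrow> (\<forall>Y. ?Y \<xi> Y \<longrightarrow> (Y \<longlongrightarrow> 0) at_top)"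
      by blast
    show ?thesis
    proof (intro exI[of _ "min \<delta>\<^sub>1 \<delta>\<^sub>2"] conjI ballI impI allI)
      fix \<xi> X assume *: "\<xi> \<in> E" "nrm \<xi> < min \<delta>\<^sub>1 \<delta>\<^sub>2" "?X \<xi> X"
      obtain Y where Y: "?Y \<xi> Y" using ex *(1) by blast
      show "(X \<longlongrightarrow> 0) at_top"
      proof (rule perturbed_tendsto_0[OF \<beta> C h *(3) Y])
        fix s :: real assume "0 \<le> s"
        then have "\<bar>X s\<bar> < d" using \<delta>1[of \<xi> X s] * d by auto
        then show "\<bar>h (X s)\<bar> \<le> C * \<bar>X s\<bar>" by (rule hC)
      qed (use \<delta>2 * Y in auto)
    qed (use \<open>0 < \<delta>\<^sub>1\<close> \<open>0 < \<delta>\<^sub>2\<close> in auto)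
  qed
  ultimately show ?thesis by (simp add: asymptotically_stable_def)
qed

theorem theorem3p9:
  fixes \<beta> A :: real
    and h :: "real \<Rightarrow> real"
    and E V :: "(real \<Rightarrow> real) set"
    and nrm :: "(real \<Rightarrow> real) \<Rightarrow> real"
  assumes "0 < \<beta>" and "\<beta> < 1"
    and "A < 0"
    and "h \<in> borel_measurable borel"
    and "normed_function_space V nrm"
    and "E \<subseteq> V"
    and "\<forall>\<xi>\<in>E. continuous_on {0..} \<xi>"
  shows "((\<exists>\<delta>\<^sub>0>0. \<exists>C>0. A + C < 0 \<and> (\<forall>x. \<bar>x\<bar> < \<delta>\<^sub>0 \<longrightarrow> \<bar>h x\<bar> \<le> C * \<bar>x\<bar>)) \<longrightarrow>
           asymptotically_stable E nrm (continuous_solution \<beta> (\<lambda>x. A * x)) \<longrightarrow>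
           asymptotically_stable E nrm (continuous_solution \<beta> (\<lambda>x. A * x + h x))) \<and>
         ((\<exists>C>0. A + C < 0 \<and> (\<forall>x. \<bar>h x\<bar> \<le> C * \<bar>x\<bar>)) \<longrightarrow>
           globally_stable_in_the_large E (continuous_solution \<beta> (\<lambda>x. A * x)) \<longrightarrow>
           globally_stable_in_the_large E (continuous_solution \<beta> (\<lambda>x. A * x + h x)))"
proof (intro conjI impI)
  assume "\<exists>\<delta>\<^sub>0>0. \<exists>C>0. A + C < 0 \<and> (\<forall>x. \<bar>x\<bar> < \<delta>\<^sub>0 \<longrightarrow> \<bar>h x\<bar> \<le> C * \<bar>x\<bar>)"
    and stab: "asymptotically_stable E nrm (continuous_solution \<beta> (\<lambda>x. A * x))"
  then obtain d C where "0 < d" "0 < C" "A + C < 0" "\<And>x. \<bar>x\<bar> < d \<Longrightarrow> \<bar>h x\<bar> \<le> C * \<bar>x\<bar>"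
    by blast
  \<comment> \<open>With \<open>l = - A\<close>, the condition \<open>A + C < 0\<close> reads
    \<open>C < l\<close>.\<close>
  then show "asymptotically_stable E nrm (continuous_solution \<beta> (\<lambda>x. A * x + h x))"
    using asymptotically_stable_perturbed[of \<beta> C "- A" h d E nrm] assms stab by simp
next
  assume "\<exists>C>0. A + C < 0 \<and> (\<forall>x. \<bar>h x\<bar> \<le> C * \<bar>x\<bar>)"
    and stab: "globally_stable_in_the_large E (continuous_solution \<beta> (\<lambda>x. A * x))"
  then obtain C where C: "0 < C" "A + C < 0" "\<And>x. \<bar>h x\<bar> \<le> C * \<bar>x\<bar>"
    by blast
  show "globally_stable_in_the_large E (continuous_solution \<beta> (\<lambda>x. A * x + h x))"
    unfolding globally_stable_in_the_large_def
  proof (intro ballI allI impI)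
    fix \<xi> X assume \<xi>: "\<xi> \<in> E" and X: "continuous_solution \<beta> (\<lambda>x. A * x + h x) \<xi> X"
    \<comment> \<open>The hypothesis on the linear equation quantifies over its solutions, so one
      must be exhibited for this \<open>\<xi>\<close>.\<close>
    obtain Y where Y: "continuous_solution \<beta> (\<lambda>x. A * x) \<xi> Y"
      using ex_linear_solution[of \<beta> "- A" \<xi>] assms \<xi> by auto
    then have "(Y \<longlongrightarrow> 0) at_top"
      using stab \<xi> by (auto simp: globally_stable_in_the_large_def)
    then show "(X \<longlongrightarrow> 0) at_top"
      using perturbed_tendsto_0[of \<beta> C "- A" h \<xi> X Y] assms C X Y by simp
  qed
qed

end
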